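(* Let $N\ge 2$, $M\ge 2$ be integers, let $0<r\le 1/N$, let $\{f_1,\dots,f_N\}$ be an IFS on $[0,1]$ as in the context, let $\mathbf{p}=(p_1,\dots,p_N)$ be a probability vector, and let $F=F(\omega)$ be the random set defined in the context. If $$M\le \min\left\{\prod_{i=1}^N p_i^{-p_i},\ \frac{1}{p_1^2+\dots+p_N^2}\right\},$$ then, for $\mu_{\mathbf p}$-almost every $\omega$, $$\dim_H F(\omega)=\dim_B F(\omega)=-\frac{\log M}{\log r}.$$
   Context: IFS: $f_i:[0,1]\to[0,1]$, $f_i(x)=rx+b_i$ for $i=1,\dots,N$, with constants $b_i$ such that the open intervals $f_i((0,1))$ are pairwise disjoint and $f_i([0,1])$ lies to the left of $f_j([0,1])$ when $i<j$. Probability space: $\Omega=\{1,\dots,N\}^{\mathbb N}$ ($\mathbb N=\{1,2,\dots\}$) with its Borel $\sigma$-algebra and the product measure $\mu_{\mathbf p}$ under which the coordinates $\omega_1,\omega_2,\dots$ are i.i.d. with $\mu_{\mathbf p}(\omega_k=i)=p_i$. Tree: let $\mathcal I_n=\{1,\dots,M\}^n$, $\mathcal I_0=\{\epsilon\}$ with $\epsilon$ the empty word, $\mathcal I^*=\bigcup_{n\ge0}\mathcal I_n$, and $\mathcal I=\{1,\dots,M\}^{\mathbb N}$. Order $\mathcal I^*$ by: $\mathbf i<_*\mathbf j$ if $\mathbf i$ is shorter than $\mathbf j$, or if they have equal length and $\mathbf i$ precedes $\mathbf j$ lexicographically. Put $\kappa(\mathbf i)=\#\{\mathbf j\in\mathcal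 I^*:\mathbf j<_*\mathbf i\}$, so that $\kappa$ maps the nonempty words bijectively onto $\mathbb N$. For nonempty $\mathbf i\in\mathcal I^*$ let $X_{\mathbf i}(\omega)=\omega_{\kappa(\mathbf i)}$ (the random label of the edge of the $M$-ary tree leading to the node $\mathbf i$). Random set: writing $\mathbf i|_k=(i_1,\dots,i_k)$, $$F(\omega)=\Big\{x:\ \{x\}=\bigcap_{n\ge1} f_{X_{\mathbf i|_1}(\omega)}\circ f_{X_{\mathbf i|_2}(\omega)}\circ\dots\circ f_{X_{\mathbf i|_n}(\omega)}([0,1])\ \text{ for some }\mathbf i\in\mathcal I\Big\}.$$ $\dim_H$ and $\dim_B$ are Hausdorff and box-counting dimension (the claim includes that the box-counting dimension exists). Convention: $0^0=1$. *)

theory Defs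
  imports "HOL-Probability.Probability"
begin

section \<open>Hausdorff dimension\<close>

text \<open>The term \<open>|U|\<^sup>s\<close> in the sums defining Hausdorff measure. It vanishes for the empty set and,
  by the convention \<open>0\<^sup>0 = 1\<close> (whereas \<open>0 powr 0 = 0\<close>), equals 1 for nonempty sets if \<open>s = 0\<close>.\<close>

definition diam_pow :: "real \<Rightarrow> 'a::metric_space set \<Rightarrow> ennreal" where
  "diam_pow s U =
     (if U = {} then 0 else if s = 0 then 1 else ennreal (diameter U powr s))"

text \<open>\<^const>\<open>diameter\<close> is only meaningful on bounded sets, hence the boundedness conditions below.\<close>

definition hausdorff_premeasure :: "real \<Rightarrow> real \<Rightarrow> 'a::metric_space set \<Rightarrow> ennreal" where
  "hausdorff_premeasure s \<delta> A =
     (INF U \<in> {U :: nat \<Rightarrow> 'a set. A \<subseteq> (\<Union>n. U n) \<and> (\<forall>n. bounded (U n) \<and> diameter (U n) \<le> \<delta>)}.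
        \<Sum>n. diam_pow s (U n))"

definition hausdorff_measure :: "real \<Rightarrow> 'a::metric_space set \<Rightarrow> ennreal" where
  "hausdorff_measure s A = (SUP \<delta> \<in> {0<..}. hausdorff_premeasure s \<delta> A)"

definition hausdorff_dim :: "'a::metric_space set \<Rightarrow> ereal" where
  "hausdorff_dim A = (INF s \<in> {s. 0 \<le> s \<and> hausdorff_measure s A = 0}. ereal s)"


section \<open>Box-counting dimension\<close>

definition covering_number :: "real \<Rightarrow> 'a::metric_space set \<Rightarrow> nat" where
  "covering_number \<delta> A =
     Inf {card \<U> | \<U>. finite \<U> \<and> (\<forall>U\<in>\<U>. bounded U \<and> diameter U \<le> \<delta>) \<and> A \<subseteq> \<Union>\<U>}"

text \<open>The box-counting dimension of \<open>A\<close> exists and equals \<open>d\<close>. As usual the notion is reserved for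
  nonempty bounded sets; these have finite covers by sets of any given positive diameter.\<close>

definition has_box_dim :: "'a::euclidean_space set \<Rightarrow> real \<Rightarrow> bool" where
  "has_box_dim A d \<longleftrightarrow> A \<noteq> {} \<and> bounded A \<and>
     ((\<lambda>\<delta>. ln (real (covering_number \<delta> A)) / (- ln \<delta>)) \<longlongrightarrow> d) (at_right 0)"


section \<open>The iterated function system\<close>

definition ifs_map :: "real \<Rightarrow> (nat \<Rightarrow> real) \<Rightarrow> nat \<Rightarrow> real \<Rightarrow> real" where
  "ifs_map r b i x = r * x + b i"

text \<open>Images of \<open>[0,1]\<close> under different maps may share an endpoint, so being to the left is
  expressed by a weak inequality.\<close>

definition ifs_on_unit_interval :: "nat \<Rightarrow> real \<Rightarrow> (nat \<Rightarrow> real) \<Rightarrow> bool" where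
  "ifs_on_unit_interval N r b \<longleftrightarrow>
     (\<forall>i\<in>{1..N}. ifs_map r b i ` {0..1} \<subseteq> {0..1}) \<and>
     (\<forall>i\<in>{1..N}. \<forall>j\<in>{1..N}. i \<noteq> j \<longrightarrow>
        ifs_map r b i ` {0<..<1} \<inter> ifs_map r b j ` {0<..<1} = {}) \<and>
     (\<forall>i\<in>{1..N}. \<forall>j\<in>{1..N}. i < j \<longrightarrow>
        (\<forall>x\<in>ifs_map r b i ` {0..1}. \<forall>y\<in>ifs_map r b j ` {0..1}. x \<le> y))"


section \<open>The probability space and the labelled tree\<close>

definition prob_vector :: "nat \<Rightarrow> (nat \<Rightarrow> real) \<Rightarrow> bool" where
  "prob_vector N p \<longleftrightarrow> (\<forall>i\<in>{1..N}. 0 \<le> p i) \<and> (\<Sum>i=1..N. p i) = 1"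

text \<open>The product is indexed by the positive integers. The product \<open>\<sigma>\<close>-algebra is the Borel
  \<open>\<sigma>\<close>-algebra, since the index set is countable and the factors are finite and discrete.\<close>

definition label_measure :: "nat \<Rightarrow> (nat \<Rightarrow> real) \<Rightarrow> (nat \<Rightarrow> nat) measure" where
  "label_measure N p = (\<Pi>\<^sub>M k\<in>{1..}. point_measure {1..N} (\<lambda>i. ennreal (p i)))"

text \<open>\<^const>\<open>lenlex\<close> compares words by length first and words of equal length lexicographically.\<close>

definition word_index :: "nat \<Rightarrow> nat list \<Rightarrow> nat" where
  "word_index M w = card {v \<in> lists {1..M}. (v, w) \<in> lenlex less_than}"

definition edge_label :: "nat \<Rightarrow> nat list \<Rightarrow> (nat \<Rightarrow> nat) \<Rightarrow> nat" where
  "edge_label M w \<omega> = \<omega> (word_index M w)"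

text \<open>Infinite words are indexed from 1; values at 0 are ignored.\<close>

definition infinite_words :: "nat \<Rightarrow> (nat \<Rightarrow> nat) set" where
  "infinite_words M = {w. \<forall>k\<ge>1. w k \<in> {1..M}}"

definition word_prefix :: "(nat \<Rightarrow> nat) \<Rightarrow> nat \<Rightarrow> nat list" where
  "word_prefix w k = map w [1..<Suc k]"

definition path_map ::
  "nat \<Rightarrow> real \<Rightarrow> (nat \<Rightarrow> real) \<Rightarrow> (nat \<Rightarrow> nat) \<Rightarrow> (nat \<Rightarrow> nat) \<Rightarrow> nat \<Rightarrow> real \<Rightarrow> real" where
  "path_map M r b \<omega> w n =
     foldr (\<circ>) (map (\<lambda>k. ifs_map r b (edge_label M (word_prefix w k) \<omega>)) [1..<Suc n]) id"

definition random_set :: "nat \<Rightarrow> real \<Rightarrow> (nat \<Rightarrow> real) \<Rightarrow> (nat \<Rightarrow> nat) \<Rightarrow> real set" where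
  "random_set M r b \<omega> =
     {x. \<exists>w\<in>infinite_words M. {x} = (\<Inter>n\<in>{1..}. path_map M r b \<omega> w n ` {0..1})}"


text \<open>Real power with the convention \<open>0\<^sup>0 = 1\<close>.\<close>

definition powr0 :: "real \<Rightarrow> real \<Rightarrow> real" where
  "powr0 x y = (if x = 0 \<and> y = 0 then 1 else x powr y)"

end

theory Submission
  imports Defs
begin

text \<open>
  Write \<open>q = \<Sum> p\<^sub>i\<^sup>2\<close>, the probability that two independent labels agree, and
  \<open>s = - ln M / ln r\<close>. The level-\<open>n\<close> intervals \<open>f\<^bsub>X\<^esub> \<circ> \<dots>\<close> that make up the random set \<open>F\<close> are at most
  \<open>M ^ n\<close> in number and have length \<open>r ^ n\<close>; these covers bound both dimensions by \<open>s\<close> for every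
  \<open>\<omega>\<close>.

  The lower bound rests on a second moment. The words of \<open>n\<close> labels read along two tree words that
  part after \<open>m\<close> letters agree with probability \<open>q ^ (n - m)\<close>, since all the labels after the
  branching belong to different edges. Hence the expected number of pairs of tree words of length
  \<open>n\<close> that carry the same label word is at most \<open>(n + 1) M ^ n\<close> as soon as \<open>M q \<le> 1\<close>
  (\<open>expected_coincidences\<close>); this is barely more than the \<open>M ^ n\<close> trivial pairs. The hypothesis on
  \<open>M\<close> amounts to \<open>M q \<le> 1\<close>, as \<open>1 / q\<close> is the smaller of the two bounds by Jensen's inequality.

  Summing over \<open>n\<close> with weights \<open>(x / M) ^ n\<close>, \<open>x < 1\<close>, shows that almost surely the number of
  coincidences is \<open>M ^ n\<close> up to subexponential factors (\<open>AE_summable_coincidences\<close>). Fix such an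
  \<open>\<omega>\<close>, and let \<open>\<nu>\<close> be the uniform measure on infinite tree words. A tree word is called heavy at
  level \<open>n\<close> if its label word is shared by more than \<open>x powr (- n)\<close> words of length \<open>n\<close>. By
  Markov's inequality the heavy words of level \<open>n\<close> have \<open>\<nu>\<close>-measure at most the \<open>n\<close>-th term of the
  convergent series, so outside a set of measure below \<open>1/2\<close> no prefix of large length is heavy. A
  set \<open>U\<close> of diameter at most \<open>r ^ n\<close> meets at most three level-\<open>n\<close> intervals, hence captures at
  most \<open>3 (x M) powr (- n)\<close> of the mass of the remaining words. This is the mass distribution
  principle (\<open>hausdorff_premeasure_random_set_pos\<close>): the Hausdorff premeasures of \<open>F\<close> with exponent
  \<open>t\<close>, where \<open>r powr t = 1 / (x M)\<close>, are positive. As \<open>x\<close> increases to 1, \<open>t\<close> increases to \<open>s\<close>.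
  Positivity of a premeasure at some scale bounds the Hausdorff dimension below, and since it bounds
  finite covers too, it also bounds the lower box-counting dimension.
\<close>

section \<open>Independent labels\<close>

lemma prob_space_letter:
  assumes "prob_vector N p"
  shows "prob_space (point_measure {1..N} (\<lambda>i. ennreal (p i)))"
proof (intro prob_space_point_measure)
  have "(\<Sum>i=1..N. ennreal (p i)) = ennreal (\<Sum>i=1..N. p i)"
    using assms by (intro sum_ennreal) (auto simp: prob_vector_def)
  then show "(\<Sum>i=1..N. ennreal (p i)) = 1" using assms by (simp add: prob_vector_def)
qed (use assms in \<open>auto simp: prob_vector_def\<close>)

lemma measurable_coordinate:
  fixes N :: nat
  assumes "k \<in> J"
  shows "(\<lambda>\<omega>. \<omega> k) \<in> measurable (\<Pi>\<^sub>M k\<in>J. point_measure {1..N} f) (count_space UNIV)"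
proof -
  have "(\<lambda>x. x) \<in> measurable (point_measure {1..N} f) (count_space UNIV)"
    by (auto simp: point_measure_def)
  from measurable_compose[OF measurable_component_singleton[OF assms] this]
  show ?thesis by simp
qed

lemma measurable_coincidence:
  fixes N :: nat
  assumes "a \<in> J" "b \<in> J"
  shows "Measurable.pred (\<Pi>\<^sub>M k\<in>J. point_measure {1..N} f) (\<lambda>\<omega>. \<omega> a = \<omega> b)"
proof -
  let ?P = "\<Pi>\<^sub>M k\<in>J. point_measure {1..N} f"
  have "{\<omega> \<in> space ?P. \<omega> a = \<omega> b}
      = (\<Union>c. ((\<lambda>\<omega>. \<omega> a) -` {c} \<inter> space ?P) \<inter> ((\<lambda>\<omega>. \<omega> b) -` {c} \<inter> space ?P))"
    by auto
  also have "\<dots> \<in> sets ?P"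
  proof (intro sets.countable_UN'')
    fix c
    have "(\<lambda>\<omega>. \<omega> a) -` {c} \<inter> space ?P \<in> sets ?P" "(\<lambda>\<omega>. \<omega> b) -` {c} \<inter> space ?P \<in> sets ?P"
      by (intro measurable_sets[OF measurable_coordinate] assms; simp)+
    then show "((\<lambda>\<omega>. \<omega> a) -` {c} \<inter> space ?P) \<inter> ((\<lambda>\<omega>. \<omega> b) -` {c} \<inter> space ?P) \<in> sets ?P"
      by (rule sets.Int)
  qed simp
  finally show ?thesis by (simp add: pred_def)
qed

lemma prob_space_label_measure:
  assumes "prob_vector N p"
  shows "prob_space (label_measure N p)"
  unfolding label_measure_def by (intro prob_space_PiM prob_space_letter assms)

text \<open>This is used for two different laws: that of the labels, and, with uniform weights, that of a
  random infinite word in the tree.\<close>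

lemma label_measure_cylinder:
  assumes p: "prob_vector N p" and J: "finite J" "J \<subseteq> {1..}" and g: "\<And>k. k \<in> J \<Longrightarrow> g k \<in> {1..N}"
  shows "{\<omega> \<in> space (label_measure N p). \<forall>k\<in>J. \<omega> k = g k} \<in> sets (label_measure N p)"
    and "measure (label_measure N p) {\<omega> \<in> space (label_measure N p). \<forall>k\<in>J. \<omega> k = g k} = (\<Prod>k\<in>J. p (g k))"
proof -
  define S where "S = point_measure {1..N} (\<lambda>i. ennreal (p i))"
  have p0: "p i \<ge> 0" if "i \<in> {1..N}" for i using p that by (auto simp: prob_vector_def)
  interpret product_prob_space "\<lambda>_. S" "{1..} :: nat set"
    unfolding S_def by (intro product_prob_spaceI prob_space_letter p)
  have *: "{\<omega> \<in> space (label_measure N p). \<forall>k\<in>J. \<omega> k = g k}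
      = {\<omega> \<in> space (Pi\<^sub>M {1..} (\<lambda>_. S)). \<forall>k\<in>J. \<omega> k \<in> {g k}}"
    by (auto simp: label_measure_def S_def)
  have "{g k} \<in> sets S" if "k \<in> J" for k
    using g[OF that] by (auto simp: S_def sets_point_measure)
  have "{\<omega> \<in> space (Pi\<^sub>M {1..} (\<lambda>_. S)). \<forall>k\<in>J. \<omega> k \<in> {g k}} \<in> sets (Pi\<^sub>M {1..} (\<lambda>_. S))"
    using J \<open>\<And>k. k \<in> J \<Longrightarrow> {g k} \<in> sets S\<close>
    by (intro sets.sets_Collect_finite_All sets_Collect_single) (auto simp: space_PiM PiE_iff)
  then show "{\<omega> \<in> space (label_measure N p). \<forall>k\<in>J. \<omega> k = g k} \<in> sets (label_measure N p)"
    unfolding * by (simp add: label_measure_def S_def)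
  have "emeasure (label_measure N p) {\<omega> \<in> space (label_measure N p). \<forall>k\<in>J. \<omega> k = g k}
      = (\<Prod>k\<in>J. emeasure S {g k})"
    unfolding * using emeasure_PiM_Collect[OF J(2,1), of "\<lambda>k. {g k}"] \<open>\<And>k. k \<in> J \<Longrightarrow> {g k} \<in> sets S\<close>
    by (simp add: label_measure_def S_def)
  also have "\<dots> = (\<Prod>k\<in>J. ennreal (p (g k)))"
    using g by (intro prod.cong refl) (auto simp: S_def emeasure_point_measure_finite)
  also have "\<dots> = ennreal (\<Prod>k\<in>J. p (g k))"
    using g p0 by (intro prod_ennreal) auto
  finally show "measure (label_measure N p) {\<omega> \<in> space (label_measure N p). \<forall>k\<in>J. \<omega> k = g k} = (\<Prod>k\<in>J. p (g k))"
    using g p0 by (simp add: measure_def prod_nonneg)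
qed

lemma coincidence_probability:
  assumes p: "prob_vector N p" and ab: "a \<noteq> b" "a \<ge> 1" "b \<ge> 1"
  shows "measure (label_measure N p) {\<omega> \<in> space (label_measure N p). \<omega> a = \<omega> b} = (\<Sum>i=1..N. (p i)\<^sup>2)"
proof -
  interpret prob_space "label_measure N p" by (rule prob_space_label_measure[OF p])
  define E where "E i = {\<omega> \<in> space (label_measure N p). \<forall>k\<in>{a,b}. \<omega> k = i}" for i
  have sp: "\<omega> a \<in> {1..N}" if "\<omega> \<in> space (label_measure N p)" for \<omega>
    using that ab by (auto simp: label_measure_def space_PiM space_point_measure PiE_iff)
  then have "{\<omega> \<in> space (label_measure N p). \<omega> a = \<omega> b} = (\<Union>i\<in>{1..N}. E i)"
    by (fastforce simp: E_def)
  moreover have "prob (\<Union>i\<in>{1..N}. E i) = (\<Sum>i\<in>{1..N}. prob (E i))"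
    using label_measure_cylinder(1)[OF p, of "{a,b}"] ab
    by (intro finite_measure_finite_Union) (auto simp: E_def disjoint_family_on_def)
  moreover have "prob (E i) = (p i)\<^sup>2" if "i \<in> {1..N}" for i
    using label_measure_cylinder(2)[OF p, of "{a,b}" "\<lambda>_. i"] that ab
    by (auto simp: E_def power2_eq_square)
  ultimately show ?thesis by simp
qed

text \<open>The event \<open>P\<close> depends on the coordinates in \<open>J\<close> only, so it is independent of a comparison of two
  fresh coordinates.\<close>

lemma coincidence_independent:
  assumes p: "prob_vector N p" and ab: "a \<noteq> b" "a \<ge> 1" "b \<ge> 1" "a \<notin> J" "b \<notin> J" and J: "J \<subseteq> {1..}"
    and meas: "Measurable.pred (\<Pi>\<^sub>M k\<in>J. point_measure {1..N} (\<lambda>i. ennreal (p i))) P"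
    and PJ: "\<And>\<omega>. P (restrict \<omega> J) \<longleftrightarrow> P \<omega>"
  shows "measure (label_measure N p) {\<omega> \<in> space (label_measure N p). P \<omega> \<and> \<omega> a = \<omega> b}
       = measure (label_measure N p) {\<omega> \<in> space (label_measure N p). P \<omega>} * (\<Sum>i=1..N. (p i)\<^sup>2)"
proof -
  define S where "S = point_measure {1..N} (\<lambda>i. ennreal (p i))"
  have L: "label_measure N p = (\<Pi>\<^sub>M k\<in>{1..}. S)" by (simp add: label_measure_def S_def)
  interpret product_prob_space "\<lambda>_. S" "{1..} :: nat set"
    unfolding S_def by (intro product_prob_spaceI prob_space_letter p)
  interpret Q: prob_space "label_measure N p" by (rule prob_space_label_measure[OF p])
  have "Q.indep_vars (\<lambda>_. S) (\<lambda>k \<omega>. \<omega> k) {1..}"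
  proof (subst Q.indep_vars_iff_distr_eq_PiM')
    show "distr (label_measure N p) (Pi\<^sub>M {1..} (\<lambda>i. S)) (\<lambda>x. \<lambda>i\<in>{1..}. x i)
        = (\<Pi>\<^sub>M i\<in>{1..}. distr (label_measure N p) S (\<lambda>\<omega>. \<omega> i))"
    proof -
      have "distr (label_measure N p) (Pi\<^sub>M {1..} (\<lambda>i. S)) (\<lambda>x. \<lambda>i\<in>{1..}. x i)
          = distr (label_measure N p) (Pi\<^sub>M {1..} (\<lambda>i. S)) (\<lambda>x. x)"
        by (intro distr_cong) (auto simp: L space_PiM PiE_def extensional_def)
      also have "\<dots> = (\<Pi>\<^sub>M i\<in>{1..}. S)" by (simp add: L)
      also have "\<dots> = (\<Pi>\<^sub>M i\<in>{1..}. distr (label_measure N p) S (\<lambda>\<omega>. \<omega> i))"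
        unfolding L by (intro PiM_cong refl PiM_component[symmetric]) auto
      finally show ?thesis .
    qed
  qed (auto simp: L)
  from Q.indep_var_restrict[OF this, of J "{a,b}"] ab J
  have ind: "Q.indep_var (Pi\<^sub>M J (\<lambda>_. S)) (\<lambda>\<omega>. restrict \<omega> J) (Pi\<^sub>M {a,b} (\<lambda>_. S)) (\<lambda>\<omega>. restrict \<omega> {a,b})"
    by auto
  define E where "E = {\<omega> \<in> space (Pi\<^sub>M J (\<lambda>_. S)). P \<omega>}"
  define F where "F = {\<omega> \<in> space (Pi\<^sub>M {a,b} (\<lambda>_. S)). \<omega> a = \<omega> b}"
  have E: "E \<in> sets (Pi\<^sub>M J (\<lambda>_. S))"
    using meas unfolding E_def S_def by (rule predE)
  have F: "F \<in> sets (Pi\<^sub>M {a,b} (\<lambda>_. S))"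
    unfolding F_def S_def by (intro predE measurable_coincidence) auto
  have r: "restrict \<omega> K \<in> space (Pi\<^sub>M K (\<lambda>_. S))" if "\<omega> \<in> space (label_measure N p)" "K \<subseteq> {1..}" for \<omega> K
    using that by (auto simp: L space_PiM)
  have ab': "{a,b} \<subseteq> {1..}" using ab by auto
  have "{\<omega> \<in> space (label_measure N p). P \<omega> \<and> \<omega> a = \<omega> b}
      = (\<lambda>\<omega>. (restrict \<omega> J, restrict \<omega> {a,b})) -` (E \<times> F) \<inter> space (label_measure N p)"
    using r[OF _ J] r[OF _ ab'] PJ by (auto simp: E_def F_def)
  moreover have "{\<omega> \<in> space (label_measure N p). P \<omega>} = (\<lambda>\<omega>. restrict \<omega> J) -` E \<inter> space (label_measure N p)"
    using r[OF _ J] PJ by (auto simp: E_def)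
  moreover have "{\<omega> \<in> space (label_measure N p). \<omega> a = \<omega> b} = (\<lambda>\<omega>. restrict \<omega> {a,b}) -` F \<inter> space (label_measure N p)"
    using r[OF _ ab'] by (auto simp: F_def)
  ultimately show ?thesis
    using Q.indep_varD[OF ind E F] coincidence_probability[OF p ab(1-3)] by simp
qed

section \<open>Tree words and the label words along them\<close>

definition words :: "nat \<Rightarrow> nat \<Rightarrow> nat list set" where
  "words M n = {w. set w \<subseteq> {1..M} \<and> length w = n}"

text \<open>The labels met on the way from the root to \<open>w\<close>: every nonempty prefix of \<open>w\<close> names an edge.\<close>

definition label_word :: "nat \<Rightarrow> (nat \<Rightarrow> nat) \<Rightarrow> nat list \<Rightarrow> nat list" where
  "label_word M \<omega> w = map (\<lambda>k. edge_label M (take k w) \<omega>) [1..<Suc (length w)]"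

lemma finite_words [simp]: "finite (words M n)"
  unfolding words_def by (rule finite_lists_length_eq) simp

lemma card_words: "card (words M n) = M ^ n"
  unfolding words_def by (subst card_lists_length_eq) auto

lemma words_0 [simp]: "words M 0 = {[]}"
  by (auto simp: words_def)

lemma sum_words_Suc:
  "(\<Sum>w\<in>words M (Suc n). g w) = (\<Sum>v\<in>words M n. \<Sum>a\<in>{1..M}. g (v @ [a]))"
proof -
  have "(\<Sum>v\<in>words M n. \<Sum>a\<in>{1..M}. g (v @ [a])) = (\<Sum>(v,a)\<in>words M n \<times> {1..M}. g (v @ [a]))"
    by (simp add: sum.cartesian_product)
  also have "\<dots> = (\<Sum>w\<in>words M (Suc n). g w)"
  proof (rule sum.reindex_bij_witness[where i = "\<lambda>w. (butlast w, last w)" and j = "\<lambda>(v,a). v @ [a]"])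
    fix w assume w: "w \<in> words M (Suc n)"
    then have e: "butlast w @ [last w] = w" by (intro append_butlast_last_id) (auto simp: words_def)
    have "set (butlast w @ [last w]) \<subseteq> {1..M}" unfolding e using w by (simp add: words_def)
    then show "(butlast w, last w) \<in> words M n \<times> {1..M}" using w by (auto simp: words_def)
    show "(case (butlast w, last w) of (v, a) \<Rightarrow> v @ [a]) = w" using e by simp
  qed (auto simp: words_def)
  finally show ?thesis by simp
qed

lemma length_label_word [simp]: "length (label_word M \<omega> w) = length w"
  by (simp add: label_word_def del: upt_Suc)

lemma label_word_snoc:
  "label_word M \<omega> (w @ [a]) = label_word M \<omega> w @ [edge_label M (w @ [a]) \<omega>]"
proof -
  have "[1..<Suc (length (w @ [a]))] = [1..<Suc (length w)] @ [Suc (length w)]" by simp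
  then show ?thesis by (simp add: label_word_def del: upt_Suc)
qed

lemma label_word_Nil [simp]: "label_word M \<omega> [] = []"
  by (simp add: label_word_def)

lemma finite_lenlex_below: "finite {v \<in> lists {1..M}. (v, w) \<in> lenlex less_than}"
proof (rule finite_subset)
  show "{v \<in> lists {1..M}. (v, w) \<in> lenlex less_than} \<subseteq> {v. set v \<subseteq> {1..M} \<and> length v \<le> length w}"
    using lenlex_length by auto
qed (simp add: finite_lists_length_le)

text \<open>Different edges carry different coordinates of \<open>\<omega>\<close>. The order on words is total, so of two words
  one has strictly more predecessors.\<close>

lemma inj_word_index: "inj_on (word_index M) (lists {1..M})"
proof -
  have less: "word_index M v < word_index M w"
    if "v \<in> lists {1..M}" "(v, w) \<in> lenlex less_than" for v w
    unfolding word_index_def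
  proof (rule psubset_card_mono[OF finite_lenlex_below])
    have "v \<notin> {u \<in> lists {1..M}. (u, v) \<in> lenlex less_than}"
      using lenlex_irreflexive[of less_than v] by auto
    moreover have "v \<in> {u \<in> lists {1..M}. (u, w) \<in> lenlex less_than}" using that by auto
    moreover have "(u, w) \<in> lenlex less_than" if "(u, v) \<in> lenlex less_than" for u
      using lenlex_trans[OF that \<open>(v, w) \<in> lenlex less_than\<close>] by simp
    ultimately show "{u \<in> lists {1..M}. (u, v) \<in> lenlex less_than}
        \<subset> {u \<in> lists {1..M}. (u, w) \<in> lenlex less_than}"
      by blast
  qed
  have "total (lenlex less_than)" by (intro total_lenlex) auto
  then show ?thesis
    unfolding inj_on_def total_on_def by (metis UNIV_I less less_irrefl)
qed

lemma word_index_ge_1: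
  assumes "w \<noteq> []"
  shows "word_index M w \<ge> 1"
proof -
  have "[] \<in> {v \<in> lists {1..M}. (v, w) \<in> lenlex less_than}" using assms by simp
  with finite_lenlex_below[of M w] show ?thesis
    unfolding word_index_def by (metis One_nat_def Suc_leI card_gt_0_iff empty_iff)
qed

lemma label_word_eq_iff:
  assumes "length v = n" "length w = n"
  shows "label_word M \<omega> v = label_word M \<omega> w \<longleftrightarrow>
    (\<forall>k\<in>{1..n}. \<omega> (word_index M (take k v)) = \<omega> (word_index M (take k w)))"
  using assms by (auto simp: label_word_def edge_label_def)

lemma measurable_label_word_eq:
  assumes "length v = n" "length w = n"
    and "\<And>k. k \<in> {1..n} \<Longrightarrow> word_index M (take k v) \<in> J \<and> word_index M (take k w) \<in> J"
  shows "Measurable.pred (\<Pi>\<^sub>M k\<in>J. point_measure {1..N} f) (\<lambda>\<omega>. label_word M \<omega> v = label_word M \<omega> w)"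
  unfolding label_word_eq_iff[OF assms(1,2)]
  by (intro pred_intros_finite measurable_coincidence) (use assms(3) in auto)

lemma pred_label_word_eq:
  assumes "v \<in> words M n" "w \<in> words M n"
  shows "Measurable.pred (label_measure N p) (\<lambda>\<omega>. label_word M \<omega> v = label_word M \<omega> w)"
  unfolding label_measure_def
proof (rule measurable_label_word_eq)
  show "word_index M (take k v) \<in> {1..} \<and> word_index M (take k w) \<in> {1..}" if "k \<in> {1..n}" for k
    using that assms word_index_ge_1[of "take k v" M] word_index_ge_1[of "take k w" M]
    by (cases "v = []"; cases "w = []"; auto simp: words_def)
qed (use assms in \<open>auto simp: words_def\<close>)

text \<open>Extending two words by letters that lead to different edges brings in two coordinates of \<open>\<omega>\<close> that
  differ from all those read so far. This covers both the case of words that have already parted and the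
  case of a branching at the last letter.\<close>

lemma prob_label_word_eq_snoc:
  assumes p: "prob_vector N p" and v: "v \<in> words M n" and w: "w \<in> words M n"
    and a: "a \<in> {1..M}" and c: "c \<in> {1..M}" and ne: "v @ [a] \<noteq> w @ [c]"
  defines "P \<equiv> label_measure N p"
  shows "measure P {\<omega> \<in> space P. label_word M \<omega> (v @ [a]) = label_word M \<omega> (w @ [c])}
       = measure P {\<omega> \<in> space P. label_word M \<omega> v = label_word M \<omega> w} * (\<Sum>i=1..N. (p i)\<^sup>2)"
proof -
  \<comment> \<open>the coordinates read by words of length at most \<open>n\<close>\<close>
  define J where "J = word_index M ` {u \<in> lists {1..M}. u \<noteq> [] \<and> length u \<le> n}"
  have J: "word_index M u \<in> J \<longleftrightarrow> u \<noteq> [] \<and> length u \<le> n" if "u \<in> lists {1..M}" for u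
    using that inj_word_index[of M] by (auto simp: J_def inj_on_def)
  have tk: "word_index M (take k u) \<in> J" if "u \<in> words M n" "k \<in> {1..n}" for u k
  proof (subst J)
    show "take k u \<in> lists {1..M}" using that set_take_subset[of k u] by (auto simp: words_def)
  qed (use that in \<open>auto simp: words_def\<close>)
  have va: "v @ [a] \<in> lists {1..M}" and wc: "w @ [c] \<in> lists {1..M}"
    using v w a c by (auto simp: words_def)
  have l: "length v = n" "length w = n" using v w by (auto simp: words_def)
  have "{\<omega> \<in> space P. label_word M \<omega> (v @ [a]) = label_word M \<omega> (w @ [c])}
    = {\<omega> \<in> space P. label_word M \<omega> v = label_word M \<omega> w
        \<and> \<omega> (word_index M (v @ [a])) = \<omega> (word_index M (w @ [c]))}"
    by (auto simp: label_word_snoc edge_label_def)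
  also have "measure P \<dots> = measure P {\<omega> \<in> space P. label_word M \<omega> v = label_word M \<omega> w} * (\<Sum>i=1..N. (p i)\<^sup>2)"
    unfolding P_def
  proof (rule coincidence_independent[OF p, where J = J])
    show "word_index M (v @ [a]) \<noteq> word_index M (w @ [c])"
      using ne inj_onD[OF inj_word_index _ va wc] by blast
    show "word_index M (v @ [a]) \<notin> J" "word_index M (w @ [c]) \<notin> J"
      using J[OF va] J[OF wc] l by auto
    show "word_index M (v @ [a]) \<ge> 1" "word_index M (w @ [c]) \<ge> 1"
      by (rule word_index_ge_1, simp)+
    show "J \<subseteq> {1..}" using word_index_ge_1 by (auto simp: J_def)
    show "Measurable.pred (\<Pi>\<^sub>M k\<in>J. point_measure {1..N} (\<lambda>i. ennreal (p i)))
        (\<lambda>\<omega>. label_word M \<omega> v = label_word M \<omega> w)"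
      using tk v w by (intro measurable_label_word_eq[OF l]) auto
    show "label_word M (restrict \<omega> J) v = label_word M (restrict \<omega> J) w
        \<longleftrightarrow> label_word M \<omega> v = label_word M \<omega> w" for \<omega>
      using tk v w by (simp add: label_word_eq_iff[OF l])
  qed
  finally show ?thesis .
qed

text \<open>Passing from level \<open>n\<close> to level \<open>n + 1\<close> multiplies the contribution of pairs by at most
  \<open>M\<^sup>2 q \<le> M\<close>, while the \<open>M ^ (n + 1)\<close> pairs of equal words contribute 1 each. Both the old bound times
  \<open>M\<close> and the new diagonal have order \<open>M ^ (n + 1)\<close>, which gives the linear factor.\<close>

lemma expected_coincidences:
  assumes p: "prob_vector N p" and M: "real M * (\<Sum>i=1..N. (p i)\<^sup>2) \<le> 1"
  shows "(\<Sum>v\<in>words M n. \<Sum>w\<in>words M n.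
      measure (label_measure N p) {\<omega> \<in> space (label_measure N p). label_word M \<omega> v = label_word M \<omega> w})
    \<le> (real n + 1) * real M ^ n"
proof -
  define q where "q = (\<Sum>i=1..N. (p i)\<^sup>2)"
  define m where "m v w = measure (label_measure N p) {\<omega> \<in> space (label_measure N p). label_word M \<omega> v = label_word M \<omega> w}" for v w
  have q0: "q \<ge> 0" unfolding q_def by (intro sum_nonneg) auto
  have m0: "m v w \<ge> 0" and m1: "m v w \<le> 1" for v w
    by (simp_all add: m_def prob_space.prob_le_1[OF prob_space_label_measure[OF p]])
  have "(\<Sum>v\<in>words M n. \<Sum>w\<in>words M n. m v w) \<le> (real n + 1) * real M ^ n"
  proof (induction n)
    case 0
    then show ?case using m1 by simp
  next
    case (Suc n)
    have step: "m (v @ [a]) (w @ [c]) \<le> m v w * q + (if v @ [a] = w @ [c] then 1 else 0)"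
      if "v \<in> words M n" "w \<in> words M n" "a \<in> {1..M}" "c \<in> {1..M}" for v w a c
      using prob_label_word_eq_snoc[OF p that] m1[of "v@[a]" "w@[c]"]
        mult_nonneg_nonneg[OF m0[of v w] q0]
      by (auto simp: m_def q_def)
    have "(\<Sum>v\<in>words M (Suc n). \<Sum>w\<in>words M (Suc n). m v w)
        = (\<Sum>v\<in>words M n. \<Sum>a\<in>{1..M}. \<Sum>w\<in>words M n. \<Sum>c\<in>{1..M}. m (v @ [a]) (w @ [c]))"
      by (simp add: sum_words_Suc)
    also have "\<dots> \<le> (\<Sum>v\<in>words M n. \<Sum>a\<in>{1..M}. \<Sum>w\<in>words M n. \<Sum>c\<in>{1..M}.
        m v w * q + (if v @ [a] = w @ [c] then 1 else 0))"
      by (intro sum_mono step)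
    also have "\<dots> = (\<Sum>v\<in>words M n. \<Sum>a\<in>{1..M}. \<Sum>w\<in>words M n. \<Sum>c\<in>{1..M}. m v w * q)
        + (\<Sum>v\<in>words M n. \<Sum>a\<in>{1..M}. \<Sum>w\<in>words M n. \<Sum>c\<in>{1..M}. if v @ [a] = w @ [c] then 1 else 0)"
      by (simp only: sum.distrib)
    also have "(\<Sum>v\<in>words M n. \<Sum>a\<in>{1..M}. \<Sum>w\<in>words M n. \<Sum>c\<in>{1..M}. if v @ [a] = w @ [c] then 1 else 0)
        = (\<Sum>v\<in>words M (Suc n). \<Sum>w\<in>words M (Suc n). if v = w then 1 else (0::real))"
      by (simp add: sum_words_Suc)
    also have "\<dots> = real M ^ Suc n"
      by (simp add: card_words)
    also have "(\<Sum>v\<in>words M n. \<Sum>a\<in>{1..M}. \<Sum>w\<in>words M n. \<Sum>c\<in>{1..M}. m v w * q)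
        = (real M * q) * real M * (\<Sum>v\<in>words M n. \<Sum>w\<in>words M n. m v w)"
      by (simp add: sum_distrib_left sum_distrib_right mult_ac)
    also have "\<dots> \<le> 1 * real M * ((real n + 1) * real M ^ n)"
      using M Suc m0 by (intro mult_mono) (auto simp: q_def intro!: sum_nonneg mult_nonneg_nonneg)
    finally show ?case by (simp add: algebra_simps)
  qed
  then show ?thesis by (simp add: m_def)
qed

section \<open>Almost sure growth of the number of coincidences\<close>

definition coincidences :: "nat \<Rightarrow> (nat \<Rightarrow> nat) \<Rightarrow> nat \<Rightarrow> nat" where
  "coincidences M \<omega> n =
     card {(v, w). v \<in> words M n \<and> w \<in> words M n \<and> label_word M \<omega> v = label_word M \<omega> w}"

lemma coincidences_eq_sum:
  "real (coincidences M \<omega> n) =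
    (\<Sum>v\<in>words M n. \<Sum>w\<in>words M n. if label_word M \<omega> v = label_word M \<omega> w then 1 else 0)"
proof -
  have "{(v, w). v \<in> words M n \<and> w \<in> words M n \<and> label_word M \<omega> v = label_word M \<omega> w}
      = {z \<in> words M n \<times> words M n. label_word M \<omega> (fst z) = label_word M \<omega> (snd z)}"
    by auto
  moreover have "real (card {z \<in> words M n \<times> words M n. label_word M \<omega> (fst z) = label_word M \<omega> (snd z)})
      = (\<Sum>z\<in>words M n \<times> words M n. if label_word M \<omega> (fst z) = label_word M \<omega> (snd z) then 1 else 0)"
    by (subst sum.If_cases) (auto simp: Collect_conj_eq)
  ultimately show ?thesis
    by (simp add: coincidences_def sum.cartesian_product case_prod_unfold)
qed

lemma nn_integral_coincidences:
  assumes p: "prob_vector N p" and M: "real M * (\<Sum>i=1..N. (p i)\<^sup>2) \<le> 1"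
  shows "(\<integral>\<^sup>+\<omega>. ennreal (real (coincidences M \<omega> n)) \<partial>label_measure N p) \<le> ennreal ((real n + 1) * real M ^ n)"
proof -
  let ?P = "label_measure N p"
  let ?E = "\<lambda>v w. {\<omega> \<in> space ?P. label_word M \<omega> v = label_word M \<omega> w}"
  interpret prob_space ?P by (rule prob_space_label_measure[OF p])
  have E: "?E v w \<in> sets ?P" if "v \<in> words M n" "w \<in> words M n" for v w
    using pred_label_word_eq[OF that, of N p] by (rule predE)
  have "(\<integral>\<^sup>+\<omega>. ennreal (real (coincidences M \<omega> n)) \<partial>?P)
      = (\<integral>\<^sup>+\<omega>. (\<Sum>v\<in>words M n. \<Sum>w\<in>words M n. indicator (?E v w) \<omega>) \<partial>?P)"
  proof (rule nn_integral_cong)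
    fix \<omega> assume "\<omega> \<in> space ?P"
    have "ennreal (real (coincidences M \<omega> n))
        = (\<Sum>v\<in>words M n. \<Sum>w\<in>words M n. ennreal (if label_word M \<omega> v = label_word M \<omega> w then 1 else 0))"
      by (simp add: coincidences_eq_sum sum_nonneg flip: sum_ennreal)
    also have "\<dots> = (\<Sum>v\<in>words M n. \<Sum>w\<in>words M n. indicator (?E v w) \<omega>)"
      using \<open>\<omega> \<in> space ?P\<close> by (intro sum.cong refl) (auto simp: indicator_def)
    finally show "ennreal (real (coincidences M \<omega> n)) = (\<Sum>v\<in>words M n. \<Sum>w\<in>words M n. indicator (?E v w) \<omega>)" .
  qed
  also have "\<dots> = (\<Sum>v\<in>words M n. \<Sum>w\<in>words M n. emeasure ?P (?E v w))"
    using E by (subst nn_integral_sum, force)+ (auto intro!: sum.cong simp: nn_integral_sum)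
  also have "\<dots> = ennreal (\<Sum>v\<in>words M n. \<Sum>w\<in>words M n. prob (?E v w))"
    by (simp add: emeasure_eq_measure sum_nonneg flip: sum_ennreal)
  also have "\<dots> \<le> ennreal ((real n + 1) * real M ^ n)"
    using expected_coincidences[OF p M, of n] by (rule ennreal_leI)
  finally show ?thesis .
qed

lemma measurable_coincidences [measurable]:
  "(\<lambda>\<omega>. ennreal (real (coincidences M \<omega> n))) \<in> borel_measurable (label_measure N p)"
  unfolding coincidences_eq_sum
  by (intro measurable_compose[OF _ measurable_ennreal] borel_measurable_sum
      measurable_If measurable_const pred_label_word_eq[unfolded pred_def]) auto

text \<open>For a single \<open>x\<close> the series has expectation at most \<open>\<Sum> (n + 1) x ^ n < \<infinity>\<close>. The terms increase with
  \<open>x\<close>, so a sequence of values tending to 1 yields one null set that serves all \<open>x < 1\<close>.\<close>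

lemma AE_summable_coincidences:
  assumes p: "prob_vector N p" and M0: "M > 0" and M: "real M * (\<Sum>i=1..N. (p i)\<^sup>2) \<le> 1"
  shows "AE \<omega> in label_measure N p.
    \<forall>x. 0 < x \<and> x < 1 \<longrightarrow> summable (\<lambda>n. (x / real M) ^ n * real (coincidences M \<omega> n))"
proof -
  let ?P = "label_measure N p"
  have one: "AE \<omega> in ?P. summable (\<lambda>n. (x / real M) ^ n * real (coincidences M \<omega> n))"
    if x: "0 < x" "x < 1" for x
  proof -
    have "(\<integral>\<^sup>+\<omega>. (\<Sum>n. ennreal ((x / real M) ^ n * real (coincidences M \<omega> n))) \<partial>?P)
        = (\<Sum>n. ennreal ((x / real M) ^ n) * (\<integral>\<^sup>+\<omega>. ennreal (real (coincidences M \<omega> n)) \<partial>?P))"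
      using x M0
      by (simp add: ennreal_mult nn_integral_suminf nn_integral_cmult measurable_coincidences
          borel_measurable_times_ennreal)
    also have "\<dots> \<le> (\<Sum>n. ennreal (real (Suc n) * x ^ n))"
    proof (intro suminf_le summableI)
      fix n
      have "ennreal ((x / real M) ^ n) * (\<integral>\<^sup>+\<omega>. ennreal (real (coincidences M \<omega> n)) \<partial>?P)
          \<le> ennreal ((x / real M) ^ n) * ennreal ((real n + 1) * real M ^ n)"
        by (intro mult_left_mono nn_integral_coincidences p M) auto
      also have "\<dots> = ennreal ((x / real M) ^ n * ((real n + 1) * real M ^ n))"
        using x M0 by (simp add: ennreal_mult)
      also have "(x / real M) ^ n * ((real n + 1) * real M ^ n) = real (Suc n) * x ^ n"
        using M0 by (simp add: power_divide)
      finally show "ennreal ((x / real M) ^ n) * (\<integral>\<^sup>+\<omega>. ennreal (real (coincidences M \<omega> n)) \<partial>?P)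
          \<le> ennreal (real (Suc n) * x ^ n)" .
    qed
    also have "\<dots> = ennreal (\<Sum>n. real (Suc n) * x ^ n)"
      using x geometric_deriv_sums[of x] by (intro suminf_ennreal2) (auto simp: sums_iff)
    also have "\<dots> < \<infinity>" by simp
    finally have "(\<integral>\<^sup>+\<omega>. (\<Sum>n. ennreal ((x / real M) ^ n * real (coincidences M \<omega> n))) \<partial>?P) \<noteq> \<infinity>"
      by simp
    moreover have "(\<lambda>\<omega>. \<Sum>n. ennreal ((x / real M) ^ n * real (coincidences M \<omega> n))) \<in> borel_measurable ?P"
    proof -
      have "(\<lambda>\<omega>. \<Sum>n. ennreal ((x / real M) ^ n) * ennreal (real (coincidences M \<omega> n))) \<in> borel_measurable ?P"
        by measurable
      then show ?thesis using x by (simp add: ennreal_mult)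
    qed
    ultimately have "AE \<omega> in ?P. (\<Sum>n. ennreal ((x / real M) ^ n * real (coincidences M \<omega> n))) \<noteq> \<infinity>"
      by (intro nn_integral_PInf_AE)
    then show ?thesis
    proof eventually_elim
      case (elim \<omega>)
      then show ?case using x M0 by (intro summable_suminf_not_top) auto
    qed
  qed
  have "AE \<omega> in ?P. \<forall>k. summable (\<lambda>n. ((1 - inverse (real (k + 2))) / real M) ^ n * real (coincidences M \<omega> n))"
    unfolding AE_all_countable by (intro allI one) (auto simp: field_simps)
  then show ?thesis
  proof eventually_elim
    case (elim \<omega>)
    show ?case
    proof (intro allI impI)
      fix x :: real assume x: "0 < x \<and> x < 1"
      then obtain k where "inverse (real (Suc k)) < 1 - x" using reals_Archimedean[of "1 - x"] by auto
      moreover have "inverse (real (k + 2)) \<le> inverse (real (Suc k))" by (simp add: field_simps)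
      ultimately have k: "x \<le> 1 - inverse (real (k + 2))" by linarith
      show "summable (\<lambda>n. (x / real M) ^ n * real (coincidences M \<omega> n))"
      proof (rule summable_comparison_test'[OF elim[rule_format, of k], where N = 0])
        fix n
        have "(x / real M) ^ n \<le> ((1 - inverse (real (k + 2))) / real M) ^ n"
          using x k by (intro power_mono divide_right_mono) auto
        then show "norm ((x / real M) ^ n * real (coincidences M \<omega> n))
            \<le> ((1 - inverse (real (k + 2))) / real M) ^ n * real (coincidences M \<omega> n)"
          using x by (simp add: mult_right_mono)
      qed
    qed
  qed
qed

section \<open>The intervals of the iterated function system\<close>

text \<open>The left endpoint of the image of \<open>[0,1]\<close> under the composition of the maps with indices \<open>u\<close>, which
  has slope \<open>r ^ length u\<close>.\<close>

primrec left_end :: "real \<Rightarrow> (nat \<Rightarrow> real) \<Rightarrow> nat list \<Rightarrow> real" where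
  "left_end r b [] = 0"
| "left_end r b (a # u) = b a + r * left_end r b u"

definition cylinder :: "real \<Rightarrow> (nat \<Rightarrow> real) \<Rightarrow> nat list \<Rightarrow> real set" where
  "cylinder r b u = {left_end r b u .. left_end r b u + r ^ length u}"

lemma ifs_offset_bounds:
  assumes "ifs_on_unit_interval N r b" "a \<in> {1..N}"
  shows "0 \<le> b a" "b a + r \<le> 1"
proof -
  have "ifs_map r b a ` {0..1} \<subseteq> {0..1}" using assms by (auto simp: ifs_on_unit_interval_def)
  then have "ifs_map r b a 0 \<in> {0..1}" "ifs_map r b a 1 \<in> {0..1}" by (auto simp: image_subset_iff)
  then show "0 \<le> b a" "b a + r \<le> 1" by (auto simp: ifs_map_def)
qed

lemma ifs_offset_gap:
  assumes "ifs_on_unit_interval N r b" "a \<in> {1..N}" "c \<in> {1..N}" "a < c"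
  shows "b a + r \<le> b c"
proof -
  have "\<forall>x\<in>ifs_map r b a ` {0..1}. \<forall>y\<in>ifs_map r b c ` {0..1}. x \<le> y"
    using assms by (auto simp: ifs_on_unit_interval_def)
  then have "ifs_map r b a 1 \<le> ifs_map r b c 0" by auto
  then show ?thesis by (simp add: ifs_map_def)
qed

lemma left_end_bounds:
  assumes ifs: "ifs_on_unit_interval N r b" and r: "0 < r" and u: "set u \<subseteq> {1..N}"
  shows "0 \<le> left_end r b u \<and> left_end r b u + r ^ length u \<le> 1"
  using u
proof (induction u)
  case (Cons a u)
  then have IH: "0 \<le> left_end r b u" "left_end r b u + r ^ length u \<le> 1" by auto
  from IH(2) r have "r * (left_end r b u + r ^ length u) \<le> r * 1" by (intro mult_left_mono) auto
  then show ?case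
    using ifs_offset_bounds[OF ifs, of a] Cons.prems IH r by (auto simp: algebra_simps)
qed simp

lemma left_end_snoc: "left_end r b (u @ [a]) = left_end r b u + r ^ length u * b a"
  by (induction u) (auto simp: algebra_simps)

lemma cylinder_snoc_subset:
  assumes "ifs_on_unit_interval N r b" "0 < r" "a \<in> {1..N}"
  shows "cylinder r b (u @ [a]) \<subseteq> cylinder r b u"
proof -
  have "0 \<le> r ^ length u * b a" using ifs_offset_bounds[OF assms(1,3)] assms(2) by simp
  moreover have "r ^ length u * (b a + r) \<le> r ^ length u * 1"
    using ifs_offset_bounds[OF assms(1,3)] assms(2) by (intro mult_left_mono) auto
  ultimately show ?thesis by (auto simp: cylinder_def left_end_snoc algebra_simps)
qed

text \<open>At the first letter where the words differ, the two images lie side by side in the order of the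
  letters; the common prefix scales their distance by a power of \<open>r\<close>.\<close>

lemma left_end_separated:
  assumes ifs: "ifs_on_unit_interval N r b" and r: "0 < r"
    and "length u = length v" "set u \<subseteq> {1..N}" "set v \<subseteq> {1..N}" "u \<noteq> v"
  shows "r ^ length u \<le> \<bar>left_end r b u - left_end r b v\<bar>"
  using assms(3-)
proof (induction u v rule: list_induct2)
  case (Cons a u c v)
  have ordered: "r ^ Suc (length u) \<le> left_end r b (c # v) - left_end r b (a # u)"
    if "a < c" "a \<in> {1..N}" "c \<in> {1..N}" "set u \<subseteq> {1..N}" "set v \<subseteq> {1..N}" for a c u v
  proof -
    have "r * (left_end r b u + r ^ length u) \<le> r * 1" "0 \<le> r * left_end r b v"
      using left_end_bounds[OF ifs r] that r by (auto intro: mult_left_mono)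
    then show ?thesis using ifs_offset_gap[OF ifs that(2,3,1)] by (simp add: algebra_simps)
  qed
  consider "a = c" | "a < c" | "c < a" by linarith
  then show ?case
  proof cases
    case 1
    then have "r ^ length u \<le> \<bar>left_end r b u - left_end r b v\<bar>" using Cons by auto
    then have "r * r ^ length u \<le> r * \<bar>left_end r b u - left_end r b v\<bar>" using r by simp
    also have "\<dots> = \<bar>r * (left_end r b u - left_end r b v)\<bar>" using r by (simp add: abs_mult)
    finally show ?thesis using 1 by (simp add: algebra_simps)
  next
    case 2
    with ordered[of a c u v] Cons.prems show ?thesis by simp
  next
    case 3
    with ordered[of c a v u] Cons.prems Cons.hyps show ?thesis by simp
  qed
qed simp

text \<open>Rounding down the coordinate in units of \<open>L\<close> separates the points, and takes only the values 0, 1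
  and 2 on an interval of length \<open>2 L\<close>.\<close>

lemma card_separated_le_3:
  fixes S :: "real set"
  assumes L: "L > 0" and sep: "\<And>x y. x \<in> S \<Longrightarrow> y \<in> S \<Longrightarrow> x \<noteq> y \<Longrightarrow> L \<le> \<bar>x - y\<bar>"
    and S: "S \<subseteq> {c .. c + 2 * L}"
  shows "finite S \<and> card S \<le> 3"
proof -
  define h where "h x = \<lfloor>(x - c) / L\<rfloor>" for x
  have inj: "inj_on h S"
  proof (rule inj_onI, rule ccontr)
    fix x y assume xy: "x \<in> S" "y \<in> S" "h x = h y" "x \<noteq> y"
    have "\<bar>(x - c) / L - (y - c) / L\<bar> < 1" using xy(3) unfolding h_def by linarith
    moreover have "(x - c) / L - (y - c) / L = (x - y) / L" by (simp add: diff_divide_distrib)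
    ultimately have "\<bar>x - y\<bar> < L" using L by (simp add: abs_divide)
    with sep[OF xy(1,2,4)] show False by simp
  qed
  have "h ` S \<subseteq> {0..2}"
  proof
    fix k assume "k \<in> h ` S"
    then obtain x where x: "x \<in> S" "k = h x" by auto
    with S have "0 \<le> (x - c) / L" "(x - c) / L \<le> 2" using L by (auto simp: field_simps)
    then show "k \<in> {0..2}" unfolding x(2) h_def by (auto simp: floor_le_iff le_floor_iff)
  qed
  then have "finite (h ` S)" "card (h ` S) \<le> 3"
    using finite_subset card_mono[of "{0..2::int}" "h ` S"] by auto
  then show ?thesis using inj by (simp add: card_image finite_image_iff)
qed

text \<open>Left endpoints of level-\<open>n\<close> intervals are \<open>r ^ n\<close> apart, and those of intervals meeting \<open>U\<close> lie
  within \<open>r ^ n\<close> to the left of a point of \<open>U\<close>, so in an interval of length \<open>2 r ^ n\<close>.\<close>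

lemma few_cylinders_meet:
  assumes ifs: "ifs_on_unit_interval N r b" and r: "0 < r"
    and U: "bounded U" "diameter U \<le> r ^ n"
    and D: "\<And>u. u \<in> D \<Longrightarrow> length u = n \<and> set u \<subseteq> {1..N} \<and> cylinder r b u \<inter> U \<noteq> {}"
  shows "card D \<le> 3"
proof (cases "D = {}")
  case False
  then obtain u0 where "u0 \<in> D" by blast
  with D[of u0] obtain y where y: "y \<in> U" by auto
  have rn: "r ^ n > 0" using r by simp
  have sep: "r ^ n \<le> \<bar>left_end r b u - left_end r b v\<bar>" if "u \<in> D" "v \<in> D" "u \<noteq> v" for u v
    using left_end_separated[OF ifs r, of u v] D[OF that(1)] D[OF that(2)] that(3) by auto
  have inj: "inj_on (left_end r b) D"
  proof (rule inj_onI, rule ccontr)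
    fix u v assume "u \<in> D" "v \<in> D" "left_end r b u = left_end r b v" "u \<noteq> v"
    with sep[of u v] rn show False by simp
  qed
  have hit: "\<exists>z\<in>U. left_end r b u \<le> z \<and> z \<le> left_end r b u + r ^ n" if "u \<in> D" for u
    using D[OF that] by (auto simp: cylinder_def)
  define m where "m = Inf U"
  have bb: "bdd_below U" using U(1) by (rule bounded_imp_bdd_below)
  have low: "m \<le> z" if "z \<in> U" for z using that bb by (simp add: m_def cInf_lower)
  have up: "z \<le> m + r ^ n" if "z \<in> U" for z
  proof -
    have "z - r ^ n \<le> m" unfolding m_def
    proof (rule cInf_greatest)
      fix z' assume "z' \<in> U"
      then have "dist z z' \<le> r ^ n" using diameter_bounded_bound[OF U(1) that, of z'] U(2) by simp
      then show "z - r ^ n \<le> z'" by (simp add: dist_real_def)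
    qed (use y in auto)
    then show ?thesis by simp
  qed
  have "left_end r b ` D \<subseteq> {m - r ^ n .. (m - r ^ n) + 2 * r ^ n}"
  proof
    fix x assume "x \<in> left_end r b ` D"
    then obtain u where u: "u \<in> D" "x = left_end r b u" by auto
    from hit[OF u(1)] obtain z where z: "z \<in> U" "x \<le> z" "z \<le> x + r ^ n" using u by auto
    then show "x \<in> {m - r ^ n .. (m - r ^ n) + 2 * r ^ n}" using low[OF z(1)] up[OF z(1)] by auto
  qed
  moreover have "r ^ n \<le> \<bar>x - y\<bar>"
    if xy: "x \<in> left_end r b ` D" "y \<in> left_end r b ` D" "x \<noteq> y" for x y
  proof -
    from xy obtain u v where uv: "u \<in> D" "v \<in> D" "x = left_end r b u" "y = left_end r b v" by auto
    with xy(3) sep[of u v] show ?thesis by auto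
  qed
  ultimately have "card (left_end r b ` D) \<le> 3"
    using card_separated_le_3[OF rn, of "left_end r b ` D" "m - r ^ n"] by simp
  then show ?thesis using inj by (simp add: card_image)
qed simp

lemma composition_eq_affine:
  "foldr (\<circ>) (map (\<lambda>k. ifs_map r b (g k)) ks) id x = left_end r b (map g ks) + r ^ length ks * x"
  by (induction ks) (auto simp: ifs_map_def algebra_simps)

lemma word_prefix_in_words:
  assumes "w \<in> infinite_words M"
  shows "word_prefix w n \<in> words M n"
proof -
  have "w k \<in> {1..M}" if "k \<in> set [1..<Suc n]" for k
    using assms that unfolding infinite_words_def set_upt by simp
  then show ?thesis unfolding words_def word_prefix_def set_map by (auto simp del: upt_Suc set_upt)
qed

lemma take_word_prefix:
  assumes "k \<le> n"
  shows "take k (word_prefix w n) = word_prefix w k"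
proof -
  have "take k [1..<Suc n] = [1..<1 + k]" using assms by (intro take_upt) simp
  then show ?thesis unfolding word_prefix_def take_map by simp
qed

lemma path_map_image:
  assumes "0 < r"
  shows "path_map M r b \<omega> w n ` {0..1} = cylinder r b (label_word M \<omega> (word_prefix w n))"
proof -
  have l: "length (word_prefix w n) = n" by (simp add: word_prefix_def)
  have *: "map (\<lambda>k. edge_label M (word_prefix w k) \<omega>) [1..<Suc n] = label_word M \<omega> (word_prefix w n)"
    unfolding label_word_def l
  proof (rule map_cong[OF refl])
    fix k assume "k \<in> set [1..<Suc n]"
    then have "k \<le> n" unfolding set_upt by simp
    then show "edge_label M (word_prefix w k) \<omega> = edge_label M (take k (word_prefix w n)) \<omega>"
      by (simp only: take_word_prefix)
  qed
  have "path_map M r b \<omega> w n = (\<lambda>x. r ^ n * x + left_end r b (label_word M \<omega> (word_prefix w n)))"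
    unfolding path_map_def by (rule ext) (simp only: composition_eq_affine *, simp del: upt_Suc)
  then show ?thesis
    using assms by (simp add: image_affinity_atLeastAtMost cylinder_def l add.commute)
qed

lemma set_label_word:
  assumes "\<And>k. k \<ge> 1 \<Longrightarrow> \<omega> k \<in> {1..N}"
  shows "set (label_word M \<omega> v) \<subseteq> {1..N}"
proof
  fix a assume "a \<in> set (label_word M \<omega> v)"
  then obtain k where k: "k \<in> {1..<Suc (length v)}" "a = \<omega> (word_index M (take k v))"
    unfolding label_word_def edge_label_def set_map set_upt by blast
  then have "take k v \<noteq> []" by auto
  then show "a \<in> {1..N}" using assms[OF word_index_ge_1] k by simp
qed

text \<open>The coding map: every infinite word of the tree leads to a point of the random set, because the
  nested intervals along the word shrink to a point.\<close>

lemma random_set_point: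
  assumes ifs: "ifs_on_unit_interval N r b" and r: "0 < r" "r < 1"
    and \<omega>: "\<And>k. k \<ge> 1 \<Longrightarrow> \<omega> k \<in> {1..N}" and w: "w \<in> infinite_words M"
  shows "\<exists>x\<in>random_set M r b \<omega>. \<forall>n. x \<in> cylinder r b (label_word M \<omega> (word_prefix w n))"
proof -
  define I where "I n = cylinder r b (label_word M \<omega> (word_prefix w n))" for n
  have Suc: "I (Suc n) \<subseteq> I n" for n
  proof -
    have e: "word_prefix w (Suc n) = word_prefix w n @ [w (Suc n)]" by (simp add: word_prefix_def)
    have "edge_label M (word_prefix w (Suc n)) \<omega> \<in> {1..N}"
      unfolding edge_label_def by (intro \<omega> word_index_ge_1) (simp add: e)
    then show ?thesis
      unfolding I_def e label_word_snoc by (intro cylinder_snoc_subset[OF ifs r(1)]) 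
  qed
  have I: "I n = {left_end r b (label_word M \<omega> (word_prefix w n)) .. left_end r b (label_word M \<omega> (word_prefix w n)) + r ^ n}" for n
    by (simp add: I_def cylinder_def word_prefix_def del: upt_Suc)
  have "\<exists>x. \<Inter>(range I) = {x}"
  proof (rule decreasing_closed_nest_sing)
    show "closed (I n)" "I n \<noteq> {}" for n using r by (auto simp: I)
    show "I n \<subseteq> I m" if "m \<le> n" for m n
      using that Suc by (rule lift_Suc_antimono_le[rotated])
    fix e :: real assume "e > 0"
    then obtain n where n: "r ^ n < e" using real_arch_pow_inv r by blast
    have "dist x y < e" if "x \<in> I n" "y \<in> I n" for x y
      using that n unfolding I dist_real_def by auto
    then show "\<exists>n. \<forall>x\<in>I n. \<forall>y\<in>I n. dist x y < e" by blast
  qed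
  then obtain x where x: "\<Inter>(range I) = {x}" by blast
  have "(\<Inter>n\<in>{1..}. I n) = \<Inter>(range I)"
  proof
    show "(\<Inter>n\<in>{1..}. I n) \<subseteq> \<Inter>(range I)"
    proof (clarsimp)
      fix y n assume "\<forall>k\<in>{Suc 0..}. y \<in> I k"
      then have "y \<in> I (Suc n)" by simp
      then show "y \<in> I n" using Suc by blast
    qed
  qed auto
  then have "{x} = (\<Inter>n\<in>{1..}. path_map M r b \<omega> w n ` {0..1})"
    unfolding path_map_image[OF r(1)] I_def[symmetric] using x by (rule trans[symmetric])
  then have "x \<in> random_set M r b \<omega>"
    using w unfolding random_set_def by blast
  moreover have "\<forall>n. x \<in> I n" using x by blast
  ultimately show ?thesis unfolding I_def by blast
qed

lemma random_set_cover:
  assumes ifs: "ifs_on_unit_interval N r b" and r: "0 < r"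
    and \<omega>: "\<And>k. k \<ge> 1 \<Longrightarrow> \<omega> k \<in> {1..N}"
  shows "random_set M r b \<omega> \<subseteq> (\<Union>v\<in>words M n. cylinder r b (label_word M \<omega> v))"
proof
  fix x assume "x \<in> random_set M r b \<omega>"
  then obtain w where w: "w \<in> infinite_words M" and "{x} = (\<Inter>n\<in>{1..}. path_map M r b \<omega> w n ` {0..1})"
    by (auto simp: random_set_def)
  then have x: "x \<in> cylinder r b (label_word M \<omega> (word_prefix w n))" if "n \<ge> 1" for n
    using that path_map_image[OF r] by auto
  show "x \<in> (\<Union>v\<in>words M n. cylinder r b (label_word M \<omega> v))"
  proof (cases "n \<ge> 1")
    case True
    then show ?thesis using x word_prefix_in_words[OF w] by blast
  next
    \<comment> \<open>the intersection defining the random set starts at level 1, which lies in \<open>[0,1]\<close>, the level 0 interval\<close>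
    case False
    let ?u = "label_word M \<omega> (word_prefix w 1)"
    have "set ?u \<subseteq> {1..N}" by (rule set_label_word) (rule \<omega>)
    then have "x \<in> {0..1}" using left_end_bounds[OF ifs r, of ?u] x[of 1] by (auto simp: cylinder_def)
    then have "x \<in> cylinder r b (label_word M \<omega> [])" by (simp add: cylinder_def)
    moreover have "n = 0" using False by simp
    ultimately show ?thesis by simp
  qed
qed

section \<open>Mass distribution along uniformly chosen paths\<close>

lemma prob_vector_uniform: "M \<ge> 1 \<Longrightarrow> prob_vector M (\<lambda>_. 1 / real M)"
  by (auto simp: prob_vector_def)

text \<open>Uniform weights turn the law of the labels into the law \<open>\<nu>\<close> of a path through the tree that picks
  every child with probability \<open>1 / M\<close>. The trace of an arbitrary cover on the paths need not be
  measurable; it is enclosed in sets determined by a finite prefix.\<close>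

lemma uniform_path_measure:
  assumes M: "M \<ge> 1" and S: "S \<subseteq> words M n"
  defines "\<nu> \<equiv> label_measure M (\<lambda>_. 1 / real M)"
  shows "{w \<in> space \<nu>. word_prefix w n \<in> S} \<in> sets \<nu>"
    and "emeasure \<nu> {w \<in> space \<nu>. word_prefix w n \<in> S} = ennreal (real (card S) / real M ^ n)"
proof -
  note pv = prob_vector_uniform[OF M]
  interpret prob_space \<nu> unfolding \<nu>_def by (rule prob_space_label_measure[OF pv])
  define E where "E v = {w \<in> space \<nu>. word_prefix w n = v}" for v
  have E: "E v \<in> sets \<nu> \<and> prob (E v) = 1 / real M ^ n" if "v \<in> S" for v
  proof -
    have v: "length v = n" "set v \<subseteq> {1..M}" using that S by (auto simp: words_def)
    have g: "v ! (k - 1) \<in> {1..M}" if "k \<in> {1..n}" for k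
      using that v nth_mem[of "k - 1" v] by (auto simp: subset_iff)
    have "word_prefix w n = v \<longleftrightarrow> (\<forall>k\<in>{1..n}. w k = v ! (k - 1))" for w
    proof -
      have "word_prefix w n = v \<longleftrightarrow> (\<forall>i<n. w (Suc i) = v ! i)"
        using v by (auto simp: word_prefix_def list_eq_iff_nth_eq simp del: upt_Suc)
      also have "\<dots> \<longleftrightarrow> (\<forall>k\<in>{1..n}. w k = v ! (k - 1))"
      proof (intro iffI ballI allI impI)
        fix k assume "\<forall>i<n. w (Suc i) = v ! i" "k \<in> {1..n}"
        then show "w k = v ! (k - 1)" by (cases k) auto
      next
        fix i assume h: "\<forall>k\<in>{1..n}. w k = v ! (k - 1)" "i < n"
        then have "Suc i \<in> {1..n}" by simp
        with h(1) have "w (Suc i) = v ! (Suc i - 1)" by (rule bspec)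
        then show "w (Suc i) = v ! i" by simp
      qed
      finally show ?thesis .
    qed
    then have "E v = {w \<in> space \<nu>. \<forall>k\<in>{1..n}. w k = v ! (k - 1)}" by (simp add: E_def)
    then show ?thesis
      using label_measure_cylinder[OF pv, of "{1..n}" "\<lambda>k. v ! (k - 1)"] g
      by (auto simp: \<nu>_def power_one_over)
  qed
  have fin: "finite S" using S finite_words finite_subset by blast
  have eq: "{w \<in> space \<nu>. word_prefix w n \<in> S} = (\<Union>v\<in>S. E v)" by (auto simp: E_def)
  show "{w \<in> space \<nu>. word_prefix w n \<in> S} \<in> sets \<nu>"
    unfolding eq using fin E by (intro sets.finite_UN) auto
  have "prob (\<Union>v\<in>S. E v) = (\<Sum>v\<in>S. prob (E v))"
    using fin E by (intro finite_measure_finite_Union) (auto simp: disjoint_family_on_def E_def)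
  also have "\<dots> = real (card S) / real M ^ n" using E by simp
  finally show "emeasure \<nu> {w \<in> space \<nu>. word_prefix w n \<in> S} = ennreal (real (card S) / real M ^ n)"
    unfolding eq by (simp add: emeasure_eq_measure)
qed

text \<open>The words whose label word is carried by too many words of the same length, so that the interval of
  this label word receives mass more than \<open>(x M) powr (- n)\<close> under \<open>\<nu>\<close>.\<close>

definition heavy_words :: "nat \<Rightarrow> (nat \<Rightarrow> nat) \<Rightarrow> real \<Rightarrow> nat \<Rightarrow> nat list set" where
  "heavy_words M \<omega> x n =
    {v \<in> words M n. inverse x ^ n < real (card {w \<in> words M n. label_word M \<omega> w = label_word M \<omega> v})}"

text \<open>Markov's inequality: each heavy word takes part in more than \<open>x powr (- n)\<close> coincidences.\<close>

lemma card_heavy_words: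
  assumes x: "0 < x"
  shows "real (card (heavy_words M \<omega> x n)) \<le> x ^ n * real (coincidences M \<omega> n)"
proof -
  let ?c = "\<lambda>v. real (card {w \<in> words M n. label_word M \<omega> w = label_word M \<omega> v})"
  have "real (card (heavy_words M \<omega> x n)) * inverse x ^ n = (\<Sum>v\<in>heavy_words M \<omega> x n. inverse x ^ n)"
    by simp
  also have "\<dots> \<le> (\<Sum>v\<in>heavy_words M \<omega> x n. ?c v)"
    by (intro sum_mono) (auto simp: heavy_words_def)
  also have "\<dots> \<le> (\<Sum>v\<in>words M n. ?c v)"
    by (intro sum_mono2) (auto simp: heavy_words_def)
  also have "\<dots> = real (coincidences M \<omega> n)"
    unfolding coincidences_eq_sum
  proof (intro sum.cong refl)
    fix v
    have "{w \<in> words M n. label_word M \<omega> w = label_word M \<omega> v}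
        = words M n \<inter> {w. label_word M \<omega> v = label_word M \<omega> w}" by auto
    then show "?c v = (\<Sum>w\<in>words M n. if label_word M \<omega> v = label_word M \<omega> w then 1 else 0)"
      by (subst sum.If_cases) auto
  qed
  finally have "x ^ n * (real (card (heavy_words M \<omega> x n)) * inverse x ^ n) \<le> x ^ n * real (coincidences M \<omega> n)"
    using x by (intro mult_left_mono) auto
  then show ?thesis using x by (simp add: field_simps)
qed

text \<open>At most three label words have intervals meeting \<open>U\<close>, and each of them is carried by few words,
  unless all its carriers are heavy.\<close>

lemma card_light_words_meeting:
  assumes ifs: "ifs_on_unit_interval N r b" and r: "0 < r"
    and \<omega>: "\<And>k. k \<ge> 1 \<Longrightarrow> \<omega> k \<in> {1..N}" and x: "0 < x"
    and U: "bounded U" "diameter U \<le> r ^ n"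
  shows "real (card {v \<in> words M n - heavy_words M \<omega> x n. cylinder r b (label_word M \<omega> v) \<inter> U \<noteq> {}})
    \<le> 3 * inverse x ^ n"
proof -
  define L where "L = {v \<in> words M n - heavy_words M \<omega> x n. cylinder r b (label_word M \<omega> v) \<inter> U \<noteq> {}}"
  define D where "D = label_word M \<omega> ` L"
  have finL: "finite L" by (rule finite_subset[OF _ finite_words[of M n]]) (auto simp: L_def)
  have D3: "card D \<le> 3"
  proof (rule few_cylinders_meet[OF ifs r U])
    fix u assume "u \<in> D"
    then obtain v where v: "v \<in> L" "u = label_word M \<omega> v" by (auto simp: D_def)
    then show "length u = n \<and> set u \<subseteq> {1..N} \<and> cylinder r b u \<inter> U \<noteq> {}"
      using set_label_word[of \<omega> N M v] \<omega> by (auto simp: L_def words_def)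
  qed
  have "L = (\<Union>u\<in>D. {v \<in> L. label_word M \<omega> v = u})" by (auto simp: D_def)
  then have "card L \<le> (\<Sum>u\<in>D. card {v \<in> L. label_word M \<omega> v = u})"
    using finL card_UN_le[of D "\<lambda>u. {v \<in> L. label_word M \<omega> v = u}"] by (simp add: D_def)
  then have "real (card L) \<le> (\<Sum>u\<in>D. real (card {v \<in> L. label_word M \<omega> v = u}))"
    by (simp flip: of_nat_sum)
  also have "\<dots> \<le> (\<Sum>u\<in>D. inverse x ^ n)"
  proof (rule sum_mono)
    fix u assume "u \<in> D"
    then obtain v where v: "v \<in> L" "u = label_word M \<omega> v" by (auto simp: D_def)
    have "card {w \<in> L. label_word M \<omega> w = u} \<le> card {w \<in> words M n. label_word M \<omega> w = label_word M \<omega> v}"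
      using v by (intro card_mono) (auto simp: L_def)
    also have "real \<dots> \<le> inverse x ^ n" using v by (auto simp: L_def heavy_words_def)
    finally show "real (card {w \<in> L. label_word M \<omega> w = u}) \<le> inverse x ^ n" by simp
  qed
  also have "\<dots> \<le> 3 * inverse x ^ n"
    using D3 x by (simp add: mult_right_mono)
  finally show ?thesis by (simp add: L_def)
qed

text \<open>For \<open>d > 0\<close> this is the usual choice of the last scale \<open>r ^ n \<ge> d\<close>. The slack \<open>\<eta>\<close> is there for
  sets of diameter 0: they contribute nothing to the Hausdorff sum, but their trace on the paths is
  estimated at a finite level and has to be absorbed.\<close>

lemma scale_exists:
  fixes r t d \<eta> :: real
  assumes r: "0 < r" "r < 1" and t: "t > 0" and \<eta>: "\<eta> > 0" and d: "0 \<le> d" "d \<le> r ^ n0"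
  shows "\<exists>n\<ge>n0. d \<le> r ^ n \<and> (r powr t) ^ n \<le> inverse (r powr t) * d powr t + \<eta>"
proof -
  define \<theta> where "\<theta> = r powr t"
  have \<theta>: "0 < \<theta>" "\<theta> < 1" using r t powr01_less_one[of r t] by (auto simp: \<theta>_def)
  show ?thesis
  proof (cases "d = 0")
    case True
    obtain m where m: "\<theta> ^ m < \<eta>" using real_arch_pow_inv \<theta> \<eta> by blast
    have "\<theta> ^ (m + n0) \<le> \<theta> ^ m" using \<theta> by (intro power_decreasing) auto
    with m True r show ?thesis by (intro exI[of _ "m + n0"]) (auto simp: \<theta>_def)
  next
    case False
    with d have "d > 0" by simp
    then have ex: "\<exists>m. r ^ m < d" using real_arch_pow_inv r by blast
    define m where "m = (LEAST m. r ^ m < d)"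
    have m: "r ^ m < d" unfolding m_def using ex by (rule LeastI_ex)
    have "m > n0"
    proof (rule ccontr)
      assume "\<not> m > n0"
      then have "r ^ n0 \<le> r ^ m" using r by (intro power_decreasing) auto
      then show False using m d by simp
    qed
    then obtain n where n: "m = Suc n" "n \<ge> n0" by (cases m) auto
    have dn: "d \<le> r ^ n" using not_less_Least[of n "\<lambda>m. r ^ m < d"] n by (auto simp: m_def)
    have "\<theta> ^ m = (r ^ m) powr t"
      using r by (simp add: \<theta>_def powr_powr mult.commute flip: powr_realpow)
    also have "\<dots> \<le> d powr t" using m r t by (intro powr_mono2) auto
    finally have "\<theta> * \<theta> ^ n \<le> d powr t" using n by simp
    then have "\<theta> ^ n \<le> inverse \<theta> * d powr t" using \<theta> by (simp add: field_simps)
    then show ?thesis using dn n(2) \<eta> by (intro exI[of _ n]) (auto simp: \<theta>_def)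
  qed
qed

lemma diam_pow_pos: "s > 0 \<Longrightarrow> diam_pow s U = ennreal (diameter U powr s)"
  by (simp add: diam_pow_def)

text \<open>Every path either has a heavy prefix of length at least \<open>n0\<close> or leads to a point of some \<open>U k\<close> with
  light prefixes. The first alternative has probability at most \<open>1/2\<close>, the second is bounded by a
  constant times the Hausdorff sum of the cover, up to the slack; as the total mass is 1, the sum
  cannot be small.\<close>

lemma hausdorff_premeasure_random_set_pos:
  assumes ifs: "ifs_on_unit_interval N r b" and r: "0 < r" "r < 1"
    and \<omega>: "\<And>k. k \<ge> 1 \<Longrightarrow> \<omega> k \<in> {1..N}" and M: "M \<ge> 1" and x: "0 < x"
    and summ: "summable (\<lambda>n. (x / real M) ^ n * real (coincidences M \<omega> n))"
    and t: "t > 0" and xt: "r powr t = inverse (x * real M)"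
  shows "\<exists>\<delta>>0. hausdorff_premeasure t \<delta> (random_set M r b \<omega>) > 0"
proof -
  define \<nu> where "\<nu> = label_measure M (\<lambda>_. 1 / real M)"
  interpret prob_space \<nu>
    unfolding \<nu>_def by (rule prob_space_label_measure[OF prob_vector_uniform[OF M]])
  define a where "a n = (x / real M) ^ n * real (coincidences M \<omega> n)" for n
  have a0: "a n \<ge> 0" for n using x by (simp add: a_def)
  have suma: "summable a" using summ unfolding a_def .
  define B where "B n = {w \<in> space \<nu>. word_prefix w n \<in> heavy_words M \<omega> x n}" for n
  have heavy: "heavy_words M \<omega> x n \<subseteq> words M n" for n by (auto simp: heavy_words_def)
  have B: "B n \<in> sets \<nu>" for n unfolding B_def \<nu>_def by (rule uniform_path_measure[OF M heavy])
  have Ba: "emeasure \<nu> (B n) \<le> ennreal (a n)" for n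
  proof -
    have "emeasure \<nu> (B n) = ennreal (real (card (heavy_words M \<omega> x n)) / real M ^ n)"
      unfolding B_def \<nu>_def by (rule uniform_path_measure[OF M heavy])
    also have "\<dots> \<le> ennreal (x ^ n * real (coincidences M \<omega> n) / real M ^ n)"
      by (intro ennreal_leI divide_right_mono card_heavy_words x) simp
    finally show ?thesis by (simp add: a_def power_divide)
  qed
  obtain n0 where n0: "norm (\<Sum>k. a (k + n0)) < 1 / 2"
    using suminf_exist_split[OF _ suma, of "1/2"] by auto
  have "emeasure \<nu> (\<Union>k. B (k + n0)) \<le> (\<Sum>k. emeasure \<nu> (B (k + n0)))"
    using B by (intro emeasure_subadditive_countably) auto
  also have "\<dots> \<le> (\<Sum>k. ennreal (a (k + n0)))"
    by (intro suminf_le summableI Ba)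
  also have "\<dots> = ennreal (\<Sum>k. a (k + n0))"
    using a0 suma by (intro suminf_ennreal2) (auto simp: summable_iff_shift)
  also have "\<dots> \<le> ennreal (1 / 2)" using n0 by (intro ennreal_leI) auto
  finally have bad: "emeasure \<nu> (\<Union>k. B (k + n0)) \<le> ennreal (1 / 2)" .
  define \<theta> where "\<theta> = r powr t"
  have \<theta>: "\<theta> > 0" using r by (simp add: \<theta>_def)
  have "ennreal (\<theta> / 12) \<le> (\<Sum>k. diam_pow t (U k))"
    if cov: "random_set M r b \<omega> \<subseteq> (\<Union>k. U k)" and U: "\<And>k. bounded (U k)" "\<And>k. diameter (U k) \<le> r ^ n0" for U
  proof (rule ccontr)
    assume "\<not> ?thesis"
    then have less: "(\<Sum>k. diam_pow t (U k)) < ennreal (\<theta> / 12)" by simp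
    \<comment> \<open>the slacks \<open>1/24 * (1/2) ^ k\<close> become \<open>1/4\<close> in total after the factor 3 from counting intervals,
      half of the mass that the heavy words leave\<close>
    have "\<exists>n. n0 \<le> n \<and> diameter (U k) \<le> r ^ n
        \<and> \<theta> ^ n \<le> inverse \<theta> * diameter (U k) powr t + (1 / 24) * (1 / 2) ^ k" for k
      using scale_exists[OF r t, of "(1 / 24) * (1 / 2) ^ k" "diameter (U k)" n0]
        diameter_ge_0[OF U(1)] U(2) unfolding \<theta>_def by auto
    then obtain n where n: "\<And>k. n0 \<le> n k" "\<And>k. diameter (U k) \<le> r ^ n k"
        "\<And>k. \<theta> ^ n k \<le> inverse \<theta> * diameter (U k) powr t + (1 / 24) * (1 / 2) ^ k"
      by metis
    define L where "L k = {v \<in> words M (n k) - heavy_words M \<omega> x (n k).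
        cylinder r b (label_word M \<omega> v) \<inter> U k \<noteq> {}}" for k
    have L: "L k \<subseteq> words M (n k)" for k by (auto simp: L_def)
    define A where "A k = {w \<in> space \<nu>. word_prefix w (n k) \<in> L k}" for k
    have A: "A k \<in> sets \<nu>" for k unfolding A_def \<nu>_def by (rule uniform_path_measure[OF M L])
    have A_le: "emeasure \<nu> (A k) \<le> ennreal (3 / \<theta> * diameter (U k) powr t + (1 / 8) * (1 / 2) ^ k)" for k
    proof -
      have "emeasure \<nu> (A k) = ennreal (real (card (L k)) / real M ^ n k)"
        unfolding A_def \<nu>_def by (rule uniform_path_measure[OF M L])
      also have "\<dots> \<le> ennreal (3 * inverse x ^ n k / real M ^ n k)"
        unfolding L_def
        by (intro ennreal_leI divide_right_mono card_light_words_meeting[OF ifs r(1) \<omega> x U(1) n(2)]) auto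
      also have "3 * inverse x ^ n k / real M ^ n k = 3 * \<theta> ^ n k"
        by (simp add: \<theta>_def xt field_simps)
      also have "\<dots> \<le> 3 * (inverse \<theta> * diameter (U k) powr t + (1 / 24) * (1 / 2) ^ k)"
        by (intro mult_left_mono n(3)) auto
      also have "\<dots> = 3 / \<theta> * diameter (U k) powr t + (1 / 8) * (1 / 2) ^ k"
        by (simp add: field_simps)
      finally show ?thesis by (simp add: ennreal_leI)
    qed
    have sub: "space \<nu> \<subseteq> (\<Union>k. B (k + n0)) \<union> (\<Union>k. A k)"
    proof
      fix w assume w: "w \<in> space \<nu>"
      then have "w \<in> infinite_words M"
        by (auto simp: \<nu>_def label_measure_def space_PiM space_point_measure infinite_words_def PiE_iff)
      note wI = this
      have wp: "\<And>n. word_prefix w n \<in> words M n" using wI by (rule word_prefix_in_words)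
      have "\<exists>y\<in>random_set M r b \<omega>. \<forall>n. y \<in> cylinder r b (label_word M \<omega> (word_prefix w n))"
        using ifs r \<omega> wI by (rule random_set_point)
      then obtain y where y: "y \<in> random_set M r b \<omega>" "\<And>n. y \<in> cylinder r b (label_word M \<omega> (word_prefix w n))"
        by blast
      from y(1) cov obtain k where k: "y \<in> U k" by blast
      show "w \<in> (\<Union>k. B (k + n0)) \<union> (\<Union>k. A k)"
      proof (cases "word_prefix w (n k) \<in> heavy_words M \<omega> x (n k)")
        case True
        then have "w \<in> B ((n k - n0) + n0)" using w n(1)[of k] by (simp add: B_def)
        then show ?thesis by blast
      next
        case False
        then have "w \<in> A k" using w wp y(2) k by (auto simp: A_def L_def)
        then show ?thesis by blast
      qed
    qed
    have geo: "(\<Sum>k. ennreal ((1 / 8) * (1 / 2) ^ k)) = ennreal (1 / 4)"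
    proof -
      have "(\<lambda>k. (1 / 8) * (1 / 2 :: real) ^ k) sums ((1 / 8) * (1 / (1 - 1 / 2)))"
        by (intro sums_mult geometric_sums) simp
      then show ?thesis
        by (subst suminf_ennreal2) (auto simp: sums_iff)
    qed
    have "1 = emeasure \<nu> (space \<nu>)" by (simp add: emeasure_space_1)
    also have "\<dots> \<le> emeasure \<nu> ((\<Union>k. B (k + n0)) \<union> (\<Union>k. A k))"
      using sub A B by (intro emeasure_mono) auto
    also have "\<dots> \<le> emeasure \<nu> (\<Union>k. B (k + n0)) + emeasure \<nu> (\<Union>k. A k)"
      using A B by (intro emeasure_subadditive) auto
    also have "\<dots> \<le> ennreal (1 / 2) + (\<Sum>k. emeasure \<nu> (A k))"
      using A by (intro add_mono bad emeasure_subadditive_countably) auto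
    also have "\<dots> \<le> ennreal (1 / 2) + (\<Sum>k. ennreal (3 / \<theta> * diameter (U k) powr t + (1 / 8) * (1 / 2) ^ k))"
      by (intro add_left_mono suminf_le summableI A_le)
    also have "(\<Sum>k. ennreal (3 / \<theta> * diameter (U k) powr t + (1 / 8) * (1 / 2) ^ k))
        = (\<Sum>k. ennreal (3 / \<theta>) * diam_pow t (U k) + ennreal ((1 / 8) * (1 / 2) ^ k))"
    proof (intro suminf_cong)
      fix k
      have "ennreal (3 / \<theta> * diameter (U k) powr t + (1 / 8) * (1 / 2) ^ k)
          = ennreal (3 / \<theta> * diameter (U k) powr t) + ennreal ((1 / 8) * (1 / 2) ^ k)"
        using \<theta> by (intro ennreal_plus) auto
      also have "ennreal (3 / \<theta> * diameter (U k) powr t) = ennreal (3 / \<theta>) * diam_pow t (U k)"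
        using \<theta> t by (subst ennreal_mult) (auto simp: diam_pow_pos)
      finally show "ennreal (3 / \<theta> * diameter (U k) powr t + (1 / 8) * (1 / 2) ^ k)
          = ennreal (3 / \<theta>) * diam_pow t (U k) + ennreal ((1 / 8) * (1 / 2) ^ k)" .
    qed
    also have "\<dots> = ennreal (3 / \<theta>) * (\<Sum>k. diam_pow t (U k)) + ennreal (1 / 4)"
      by (simp only: geo suminf_add[symmetric, OF summableI summableI] ennreal_suminf_cmult)
    finally have one: "1 \<le> ennreal (1 / 2) + (ennreal (3 / \<theta>) * (\<Sum>k. diam_pow t (U k)) + ennreal (1 / 4))" .
    obtain s where s: "(\<Sum>k. diam_pow t (U k)) = ennreal s" "0 \<le> s"
      using less by (cases "\<Sum>k. diam_pow t (U k)") auto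
    have "s < \<theta> / 12" using less s by (simp add: ennreal_less_iff)
    then have "1 / 2 + (3 / \<theta> * s + 1 / 4) < 1" using \<theta> by (simp add: field_simps)
    moreover have "1 \<le> ennreal (1 / 2 + (3 / \<theta> * s + 1 / 4))"
    proof -
      have "ennreal (1 / 2 + (3 / \<theta> * s + 1 / 4)) = ennreal (1 / 2) + ennreal (3 / \<theta> * s + 1 / 4)"
        using s \<theta> by (intro ennreal_plus) auto
      also have "ennreal (3 / \<theta> * s + 1 / 4) = ennreal (3 / \<theta> * s) + ennreal (1 / 4)"
        using s \<theta> by (intro ennreal_plus) auto
      also have "ennreal (3 / \<theta> * s) = ennreal (3 / \<theta>) * ennreal s"
        using s \<theta> by (intro ennreal_mult) auto
      finally show ?thesis using one s by simp
    qed
    then have "1 \<le> 1 / 2 + (3 / \<theta> * s + 1 / 4)"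
      by (rule ennreal_ge_1[THEN iffD1])
    ultimately show False by simp
  qed
  then have "ennreal (\<theta> / 12) \<le> hausdorff_premeasure t (r ^ n0) (random_set M r b \<omega>)"
    unfolding hausdorff_premeasure_def by (intro INF_greatest) auto
  moreover have "0 < ennreal (\<theta> / 12)" using \<theta> by simp
  ultimately have "0 < hausdorff_premeasure t (r ^ n0) (random_set M r b \<omega>)"
    by (rule less_le_trans[rotated])
  moreover have "0 < r ^ n0" using r by simp
  ultimately show ?thesis by blast
qed

section \<open>From premeasures and covers to dimensions\<close>

text \<open>This serves twice: geometric covers make the premeasures small, and conversely a positive premeasure
  forces finite covers to be large.\<close>

lemma hausdorff_premeasure_finite_cover:
  fixes A :: "'a::metric_space set"
  assumes fin: "finite \<U>" and U: "\<And>U. U \<in> \<U> \<Longrightarrow> bounded U \<and> diameter U \<le> \<delta>"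
    and A: "A \<subseteq> \<Union>\<U>" and \<delta>: "0 \<le> \<delta>" and s: "0 < s"
  shows "hausdorff_premeasure s \<delta> A \<le> ennreal (real (card \<U>) * \<delta> powr s)"
proof -
  obtain h where h: "bij_betw h {..<card \<U>} \<U>"
    using fin ex_bij_betw_nat_finite by (metis atLeast0LessThan)
  define V where "V k = (if k < card \<U> then h k else {})" for k
  have V: "bounded (V k) \<and> diameter (V k) \<le> \<delta>" for k
    using U h \<delta> by (auto simp: V_def bij_betw_def)
  have cov: "A \<subseteq> (\<Union>k. V k)"
  proof
    fix y assume "y \<in> A"
    then obtain X where X: "X \<in> \<U>" "y \<in> X" using A by auto
    then have "X \<in> h ` {..<card \<U>}" using h by (simp add: bij_betw_def)
    then obtain k where "k < card \<U>" "X = h k" by auto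
    then have "y \<in> V k" using X by (simp add: V_def)
    then show "y \<in> (\<Union>k. V k)" by blast
  qed
  have "hausdorff_premeasure s \<delta> A \<le> (\<Sum>k. diam_pow s (V k))"
    unfolding hausdorff_premeasure_def using V cov by (intro INF_lower) auto
  also have "\<dots> = (\<Sum>k<card \<U>. diam_pow s (V k))"
    by (rule suminf_finite) (auto simp: V_def diam_pow_def)
  also have "\<dots> \<le> (\<Sum>k<card \<U>. ennreal (\<delta> powr s))"
  proof (rule sum_mono)
    fix k
    have "diameter (V k) powr s \<le> \<delta> powr s"
      using V[of k] s by (intro powr_mono2) (auto intro: diameter_ge_0)
    then show "diam_pow s (V k) \<le> ennreal (\<delta> powr s)" using s by (simp add: diam_pow_def ennreal_leI)
  qed
  also have "\<dots> = ennreal (real (card \<U>) * \<delta> powr s)"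
    by (simp add: ennreal_mult ennreal_of_nat_eq_real_of_nat)
  finally show ?thesis .
qed

lemma hausdorff_premeasure_antimono:
  fixes A :: "'a::metric_space set"
  assumes "\<delta> \<le> \<epsilon>"
  shows "hausdorff_premeasure s \<epsilon> A \<le> hausdorff_premeasure s \<delta> A"
  unfolding hausdorff_premeasure_def
proof (intro INF_superset_mono order_refl subsetI CollectI)
  fix U :: "nat \<Rightarrow> 'a set"
  assume "U \<in> {U. A \<subseteq> (\<Union>n. U n) \<and> (\<forall>n. bounded (U n) \<and> diameter (U n) \<le> \<delta>)}"
  then show "A \<subseteq> (\<Union>n. U n) \<and> (\<forall>n. bounded (U n) \<and> diameter (U n) \<le> \<epsilon>)"
    using order_trans[OF _ assms] by simp
qed

lemma hausdorff_premeasure_antimono_exponent: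
  fixes A :: "'a::metric_space set"
  assumes "0 \<le> s" "s \<le> t" "0 < t" "\<delta> \<le> 1"
  shows "hausdorff_premeasure t \<delta> A \<le> hausdorff_premeasure s \<delta> A"
  unfolding hausdorff_premeasure_def
proof (rule INF_mono, rule bexI)
  fix U :: "nat \<Rightarrow> 'a set"
  assume U: "U \<in> {U. A \<subseteq> (\<Union>n. U n) \<and> (\<forall>n. bounded (U n) \<and> diameter (U n) \<le> \<delta>)}"
  have "diam_pow t (U n) \<le> diam_pow s (U n)" for n
  proof -
    have "bounded (U n)" "diameter (U n) \<le> \<delta>" using U by simp_all
    then have d: "0 \<le> diameter (U n)" "diameter (U n) \<le> 1"
      using assms(4) diameter_ge_0[of "U n"] by simp_all
    have "diameter (U n) powr t \<le> diameter (U n) powr s" if "s > 0"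
      using d assms by (cases "diameter (U n) = 0") (auto intro: powr_mono')
    moreover have "diameter (U n) powr t \<le> 1" using d assms by (intro powr_le1) auto
    ultimately show ?thesis using assms by (auto simp: diam_pow_def intro: ennreal_leI)
  qed
  then show "(\<Sum>n. diam_pow t (U n)) \<le> (\<Sum>n. diam_pow s (U n))"
    by (intro suminf_le summableI)
qed

text \<open>If a smaller exponent \<open>u\<close> had measure 0, so would every exponent above \<open>u\<close>, at all scales.\<close>

lemma hausdorff_dim_geI:
  assumes s: "0 < s" and pos: "\<And>t. 0 < t \<Longrightarrow> t < s \<Longrightarrow> \<exists>\<delta>>0. hausdorff_premeasure t \<delta> A > 0"
  shows "ereal s \<le> hausdorff_dim A"
  unfolding hausdorff_dim_def
proof (rule INF_greatest)
  fix u assume u: "u \<in> {s. 0 \<le> s \<and> hausdorff_measure s A = 0}"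
  show "ereal s \<le> ereal u"
  proof (rule ccontr)
    assume "\<not> ereal s \<le> ereal u"
    then have us: "u < s" by simp
    define t where "t = (u + s) / 2"
    have t: "0 < t" "u \<le> t" "t < s" using u us s by (auto simp: t_def)
    obtain \<delta> where \<delta>: "\<delta> > 0" "hausdorff_premeasure t \<delta> A > 0" using pos t by blast
    define \<epsilon> where "\<epsilon> = min \<delta> 1"
    have "0 < hausdorff_premeasure t \<delta> A" by fact
    also have "\<dots> \<le> hausdorff_premeasure t \<epsilon> A" by (rule hausdorff_premeasure_antimono) (simp add: \<epsilon>_def)
    also have "\<dots> \<le> hausdorff_premeasure u \<epsilon> A"
      using u t by (intro hausdorff_premeasure_antimono_exponent) (auto simp: \<epsilon>_def)
    also have "\<dots> \<le> hausdorff_measure u A"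
      unfolding hausdorff_measure_def using \<delta> by (intro SUP_upper) (auto simp: \<epsilon>_def)
    finally show False using u by simp
  qed
qed

text \<open>For \<open>t\<close> above the bound \<open>M r powr t < 1\<close>, so the Hausdorff sums \<open>(M r powr t) ^ n\<close> of the given
  covers tend to 0.\<close>

lemma hausdorff_dim_le_of_geometric_covers:
  fixes A :: "'a::metric_space set"
  assumes r: "0 < r" "r < 1" and M: "M \<ge> (1::nat)"
    and cov: "\<And>n. \<exists>\<U>. finite \<U> \<and> card \<U> \<le> M ^ n \<and> (\<forall>U\<in>\<U>. bounded U \<and> diameter U \<le> r ^ n) \<and> A \<subseteq> \<Union>\<U>"
  shows "hausdorff_dim A \<le> ereal (- (ln (real M) / ln r))"
proof (rule ereal_le_epsilon2)
  define s where "s = - (ln (real M) / ln r)"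
  have s0: "s \<ge> 0" using r M by (simp add: s_def divide_nonneg_neg)
  fix e :: real assume e: "e > 0"
  define t where "t = s + e"
  have t: "t > 0" using s0 e by (simp add: t_def)
  define c where "c = real M * r powr t"
  have "ln c < 0"
  proof -
    have "ln c = ln (real M) + ln (r powr t)" unfolding c_def using r M by (subst ln_mult_pos) auto
    also have "\<dots> = ln (real M) + s * ln r + e * ln r" using r by (simp add: t_def distrib_right)
    also have "s * ln r = - ln (real M)" using r by (simp add: s_def)
    also have "ln (real M) + - ln (real M) + e * ln r = e * ln r" by simp
    also have "\<dots> < 0" using e r by (simp add: mult_pos_neg)
    finally show ?thesis .
  qed
  moreover have c0: "c > 0" using r M by (simp add: c_def)
  ultimately have c1: "c < 1" by simp
  have bound: "hausdorff_premeasure t (r ^ n) A \<le> ennreal (c ^ n)" for n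
  proof -
    obtain \<U> where \<U>: "finite \<U>" "card \<U> \<le> M ^ n" "\<forall>U\<in>\<U>. bounded U \<and> diameter U \<le> r ^ n" "A \<subseteq> \<Union>\<U>"
      using cov[of n] by blast
    have "hausdorff_premeasure t (r ^ n) A \<le> ennreal (real (card \<U>) * (r ^ n) powr t)"
      using \<U> r t by (intro hausdorff_premeasure_finite_cover) auto
    also have "\<dots> \<le> ennreal (real (M ^ n) * (r ^ n) powr t)"
      using \<U>(2) by (intro ennreal_leI mult_right_mono) (auto simp del: of_nat_power)
    also have "(r ^ n) powr t = (r powr t) ^ n"
      using r by (simp add: powr_powr mult.commute flip: powr_realpow)
    finally show ?thesis by (simp add: c_def power_mult_distrib)
  qed
  have "hausdorff_premeasure t \<delta> A = 0" if \<delta>: "\<delta> > 0" for \<delta>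
  proof -
    obtain m where m: "r ^ m < \<delta>" using real_arch_pow_inv[OF \<delta>] r by blast
    have "hausdorff_premeasure t \<delta> A \<le> ennreal (c ^ (n + m))" for n
    proof -
      have "r ^ (n + m) \<le> r ^ m" using r by (intro power_decreasing) auto
      with m have "r ^ (n + m) \<le> \<delta>" by simp
      then show ?thesis using bound[of "n + m"] hausdorff_premeasure_antimono order_trans by blast
    qed
    moreover have "(\<lambda>n. ennreal (c ^ (n + m))) \<longlonglongrightarrow> ennreal 0"
      using c0 c1 by (intro tendsto_ennrealI LIMSEQ_ignore_initial_segment LIMSEQ_realpow_zero) auto
    ultimately have "hausdorff_premeasure t \<delta> A \<le> 0"
      by (intro LIMSEQ_le_const[where X = "\<lambda>n. ennreal (c ^ (n + m))"]) auto
    then show ?thesis by simp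
  qed
  then have "hausdorff_measure t A = 0"
    by (auto simp: hausdorff_measure_def)
  then have "hausdorff_dim A \<le> ereal t"
    unfolding hausdorff_dim_def using t by (intro INF_lower) auto
  then show "hausdorff_dim A \<le> ereal (- (ln (real M) / ln r)) + ereal e"
    by (simp add: t_def s_def)
qed

lemma covering_number_attained:
  assumes "\<exists>\<U>. finite \<U> \<and> (\<forall>U\<in>\<U>. bounded U \<and> diameter U \<le> \<delta>) \<and> A \<subseteq> \<Union>\<U>"
  shows "\<exists>\<U>. finite \<U> \<and> (\<forall>U\<in>\<U>. bounded U \<and> diameter U \<le> \<delta>) \<and> A \<subseteq> \<Union>\<U> \<and> card \<U> = covering_number \<delta> A"
proof -
  have "covering_number \<delta> A
      \<in> {card \<U> |\<U>. finite \<U> \<and> (\<forall>U\<in>\<U>. bounded U \<and> diameter U \<le> \<delta>) \<and> A \<subseteq> \<Union>\<U>}"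
    unfolding covering_number_def by (rule Inf_nat_def1) (use assms in simp)
  then show ?thesis by (elim CollectE exE conjE, intro exI conjI) simp_all
qed

lemma covering_number_le:
  assumes "finite \<U>" "\<And>U. U \<in> \<U> \<Longrightarrow> bounded U \<and> diameter U \<le> \<delta>" "A \<subseteq> \<Union>\<U>"
  shows "covering_number \<delta> A \<le> card \<U>"
  unfolding covering_number_def using assms by (intro cInf_lower) auto

lemma eventually_minus_ln_gt: "\<forall>\<^sub>F \<delta> in at_right 0. - ln \<delta> > (K::real)"
proof -
  have "\<forall>\<^sub>F \<delta> in at_right (0::real). ln \<delta> < - K"
    using ln_at_0 by (simp add: filterlim_at_bot_dense)
  then show ?thesis by eventually_elim simp
qed

text \<open>The upper bound uses the cover at the largest power of \<open>r\<close> not exceeding \<open>\<delta>\<close>. For the lower bound, a premeasure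
  at least \<open>c > 0\<close> forces \<open>N(\<delta>) \<delta> powr t \<ge> c\<close> for the covering numbers \<open>N(\<delta>)\<close> at all small \<open>\<delta>\<close>. The
  errors in the logarithms are bounded, hence disappear after division by \<open>- ln \<delta>\<close>.\<close>

lemma has_box_dimI:
  fixes A :: "'a::euclidean_space set"
  assumes A: "A \<noteq> {}" "bounded A" and r: "0 < r" "r < 1" and M: "M \<ge> (2::nat)"
    and cov: "\<And>n. \<exists>\<U>. finite \<U> \<and> card \<U> \<le> M ^ n \<and> (\<forall>U\<in>\<U>. bounded U \<and> diameter U \<le> r ^ n) \<and> A \<subseteq> \<Union>\<U>"
    and pos: "\<And>t. 0 < t \<Longrightarrow> t < - (ln (real M) / ln r) \<Longrightarrow> \<exists>\<delta>>0. hausdorff_premeasure t \<delta> A > 0"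
  shows "has_box_dim A (- (ln (real M) / ln r))"
proof -
  define s where "s = - (ln (real M) / ln r)"
  have s0: "s > 0" using r M by (simp add: s_def divide_pos_neg)
  have upper: "real (covering_number \<delta> A) \<le> real M ^ nat \<lceil>ln \<delta> / ln r\<rceil>
      \<and> (\<exists>\<U>. finite \<U> \<and> (\<forall>U\<in>\<U>. bounded U \<and> diameter U \<le> \<delta>) \<and> A \<subseteq> \<Union>\<U>)"
    if \<delta>: "0 < \<delta>" for \<delta>
  proof -
    define n where "n = nat \<lceil>ln \<delta> / ln r\<rceil>"
    have "ln \<delta> / ln r \<le> real n" unfolding n_def by linarith
    moreover have "ln r < 0" using r by simp
    ultimately have "real n * ln r \<le> ln \<delta>" by (simp add: neg_divide_le_eq)
    then have "ln (r ^ n) \<le> ln \<delta>" using r by (simp add: ln_realpow)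
    then have rn: "r ^ n \<le> \<delta>" using r \<delta> by simp
    obtain \<U> where \<U>: "finite \<U>" "card \<U> \<le> M ^ n" "\<forall>U\<in>\<U>. bounded U \<and> diameter U \<le> r ^ n" "A \<subseteq> \<Union>\<U>"
      using cov[of n] by blast
    have U: "\<forall>U\<in>\<U>. bounded U \<and> diameter U \<le> \<delta>" using \<U>(3) rn by force
    have "covering_number \<delta> A \<le> card \<U>" using \<U> U by (intro covering_number_le) auto
    then have "covering_number \<delta> A \<le> M ^ n" using \<U>(2) by simp
    then have "real (covering_number \<delta> A) \<le> real M ^ n" by (metis of_nat_le_iff of_nat_power)
    with U \<U> show ?thesis unfolding n_def by blast
  qed
  have lower: "\<exists>c>0. \<exists>\<delta>0>0. \<forall>\<delta>. 0 < \<delta> \<and> \<delta> \<le> \<delta>0 \<longrightarrow> c \<le> real (covering_number \<delta> A) * \<delta> powr t"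
    if t: "0 < t" "t < s" for t
  proof -
    obtain \<delta>0 where \<delta>0: "\<delta>0 > 0" "hausdorff_premeasure t \<delta>0 A > 0" using pos t unfolding s_def by blast
    \<comment> \<open>a premeasure may be infinite, and then every positive constant is a lower bound\<close>
    define c where "c = (if hausdorff_premeasure t \<delta>0 A = \<infinity> then 1 else enn2real (hausdorff_premeasure t \<delta>0 A))"
    have c: "c > 0" "ennreal c \<le> hausdorff_premeasure t \<delta>0 A"
      using \<delta>0(2) by (auto simp: c_def enn2real_positive_iff less_top)
    have "c \<le> real (covering_number \<delta> A) * \<delta> powr t" if \<delta>: "0 < \<delta>" "\<delta> \<le> \<delta>0" for \<delta>
    proof -
      obtain \<U> where \<U>: "finite \<U>" "\<forall>U\<in>\<U>. bounded U \<and> diameter U \<le> \<delta>" "A \<subseteq> \<Union>\<U>"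
          "card \<U> = covering_number \<delta> A"
        using covering_number_attained[of \<delta> A] upper[OF \<delta>(1)] by blast
      have "ennreal c \<le> hausdorff_premeasure t \<delta> A"
        using c(2) hausdorff_premeasure_antimono[OF \<delta>(2)] by (rule order_trans)
      also have "\<dots> \<le> ennreal (real (card \<U>) * \<delta> powr t)"
        using \<U> \<delta> t by (intro hausdorff_premeasure_finite_cover) auto
      finally show ?thesis using \<U>(4) by (simp add: ennreal_le_iff)
    qed
    then show ?thesis using c(1) \<delta>0(1) by blast
  qed
  have "((\<lambda>\<delta>. ln (real (covering_number \<delta> A)) / (- ln \<delta>)) \<longlongrightarrow> s) (at_right 0)"
  proof (rule order_tendstoI)
    fix a assume a: "a < s"
    define t where "t = (max a 0 + s) / 2"
    have t: "0 < t" "t < s" "a < t" using a s0 by (auto simp: t_def max_def)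
    obtain c \<delta>0 where c: "c > 0" "\<delta>0 > 0"
        "\<And>\<delta>. 0 < \<delta> \<Longrightarrow> \<delta> \<le> \<delta>0 \<Longrightarrow> c \<le> real (covering_number \<delta> A) * \<delta> powr t"
      using lower[OF t(1,2)] by blast
    have "\<forall>\<^sub>F \<delta> in at_right 0. 0 < \<delta> \<and> \<delta> < \<delta>0"
      using c(2) by (auto simp: eventually_at_right_field)
    moreover have "\<forall>\<^sub>F \<delta> in at_right 0. - ln \<delta> > max 0 (- ln c / (t - a))"
      by (rule eventually_minus_ln_gt)
    ultimately show "\<forall>\<^sub>F \<delta> in at_right 0. a < ln (real (covering_number \<delta> A)) / (- ln \<delta>)"
    proof eventually_elim
      case (elim \<delta>)
      have le: "c \<le> real (covering_number \<delta> A) * \<delta> powr t" using elim c by simp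
      then have N: "covering_number \<delta> A > 0" using c(1) by (cases "covering_number \<delta> A") auto
      have "ln c \<le> ln (real (covering_number \<delta> A) * \<delta> powr t)" using le c(1) by (intro ln_mono) auto
      also have "\<dots> = ln (real (covering_number \<delta> A)) + t * ln \<delta>"
        using N elim by (simp add: ln_mult ln_powr)
      finally have 1: "ln c - t * ln \<delta> \<le> ln (real (covering_number \<delta> A))" by simp
      have "- ln c < (- ln \<delta>) * (t - a)" using elim t by (simp add: field_simps)
      then have "a * (- ln \<delta>) < ln (real (covering_number \<delta> A))" using 1 by (simp add: algebra_simps)
      moreover have "- ln \<delta> > 0" using elim by simp
      ultimately show ?case by (simp only: pos_less_divide_eq)
    qed
  next
    fix a assume a: "s < a"
    have "\<forall>\<^sub>F \<delta> in at_right (0::real). 0 < \<delta> \<and> \<delta> < 1"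
      unfolding eventually_at_right_field by (rule exI[of _ 1]) simp
    moreover have "\<forall>\<^sub>F \<delta> in at_right 0. - ln \<delta> > max 0 (ln (real M) / (a - s))"
      by (rule eventually_minus_ln_gt)
    ultimately show "\<forall>\<^sub>F \<delta> in at_right 0. ln (real (covering_number \<delta> A)) / (- ln \<delta>) < a"
    proof eventually_elim
      case (elim \<delta>)
      define n where "n = nat \<lceil>ln \<delta> / ln r\<rceil>"
      have "0 \<le> ln \<delta> / ln r" using elim r by (simp add: divide_nonpos_neg)
      then have n: "real n \<le> ln \<delta> / ln r + 1" unfolding n_def by linarith
      have lnM: "ln (real M) \<ge> 0" using M by simp
      have "ln (real (covering_number \<delta> A)) \<le> real n * ln (real M)"
      proof (cases "covering_number \<delta> A = 0")
        case False
        then have "ln (real (covering_number \<delta> A)) \<le> ln (real M ^ n)"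
          using upper[of \<delta>] elim by (intro ln_mono) (auto simp: n_def)
        then show ?thesis using M by (simp add: ln_realpow)
      qed (use lnM in simp)
      also have "\<dots> \<le> (ln \<delta> / ln r + 1) * ln (real M)" by (intro mult_right_mono n lnM)
      also have "\<dots> = s * (- ln \<delta>) + ln (real M)" by (simp add: s_def algebra_simps)
      also have "\<dots> < a * (- ln \<delta>)"
      proof -
        have "ln (real M) < (a - s) * (- ln \<delta>)" using elim a by (simp add: field_simps)
        then show ?thesis by (simp add: algebra_simps)
      qed
      finally have "ln (real (covering_number \<delta> A)) < a * (- ln \<delta>)" .
      moreover have "- ln \<delta> > 0" using elim by simp
      ultimately show ?case by (simp only: pos_divide_less_eq)
    qed
  qed
  then show ?thesis using A unfolding has_box_dim_def s_def by simp
qed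

section \<open>The almost sure dimension\<close>

lemma random_set_geometric_covers:
  assumes ifs: "ifs_on_unit_interval N r b" and r: "0 < r"
    and \<omega>: "\<And>k. k \<ge> 1 \<Longrightarrow> \<omega> k \<in> {1..N}"
  shows "\<exists>\<U>. finite \<U> \<and> card \<U> \<le> M ^ n \<and> (\<forall>U\<in>\<U>. bounded U \<and> diameter U \<le> r ^ n)
    \<and> random_set M r b \<omega> \<subseteq> \<Union>\<U>"
proof (intro exI conjI ballI)
  let ?U = "(\<lambda>v. cylinder r b (label_word M \<omega> v)) ` words M n"
  show "finite ?U" by simp
  show "card ?U \<le> M ^ n"
    using card_image_le[OF finite_words, of "\<lambda>v. cylinder r b (label_word M \<omega> v)" M n]
    by (simp add: card_words)
  show "random_set M r b \<omega> \<subseteq> \<Union>?U" using ifs r \<omega> by (rule random_set_cover)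
  fix U assume "U \<in> ?U"
  then obtain v where v: "U = cylinder r b (label_word M \<omega> v)" "length v = n"
    by (auto simp: words_def)
  show "bounded U" unfolding v(1) cylinder_def by simp
  show "diameter U \<le> r ^ n"
    unfolding v(1) cylinder_def using r v(2) by (intro diameter_le) auto
qed

theorem corollary2p4:
  fixes N M :: nat and r :: real and b p :: "nat \<Rightarrow> real"
  assumes "N \<ge> 2" and "M \<ge> 2"
    and "0 < r" and "r \<le> 1 / real N"
    and "ifs_on_unit_interval N r b"
    and "prob_vector N p"
    and "real M \<le> min (\<Prod>i=1..N. powr0 (p i) (- p i)) (1 / (\<Sum>i=1..N. (p i)\<^sup>2))"
  shows "AE \<omega> in label_measure N p.
    hausdorff_dim (random_set M r b \<omega>) = ereal (- (ln (real M) / ln r)) \<and>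
    has_box_dim (random_set M r b \<omega>) (- (ln (real M) / ln r))"
proof -
  have "1 / real N \<le> 1 / 2" using assms(1) by (intro divide_left_mono) auto
  then have r: "0 < r" "r < 1" using assms(3,4) by linarith+
  note ifs = \<open>ifs_on_unit_interval N r b\<close>
  define s where "s = - (ln (real M) / ln r)"
  have s0: "s > 0" using r assms(2) by (simp add: s_def divide_pos_neg)
  have rs: "r powr s = inverse (real M)"
  proof -
    have "s * ln r = - ln (real M)" using r by (simp add: s_def)
    then show ?thesis using r assms(2) by (simp add: powr_def exp_minus)
  qed
  have "(\<Sum>i=1..N. (p i)\<^sup>2) \<ge> 0" by (intro sum_nonneg) auto
  then have M: "real M * (\<Sum>i=1..N. (p i)\<^sup>2) \<le> 1"
    using assms(7) by (cases "(\<Sum>i=1..N. (p i)\<^sup>2) = 0") (auto simp: le_divide_eq)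
  have "AE \<omega> in label_measure N p.
      \<forall>x. 0 < x \<and> x < 1 \<longrightarrow> summable (\<lambda>n. (x / real M) ^ n * real (coincidences M \<omega> n))"
    using assms(2) by (intro AE_summable_coincidences assms(6) M) simp
  moreover have "AE \<omega> in label_measure N p. \<omega> \<in> space (label_measure N p)"
    by (rule AE_space)
  ultimately show ?thesis
  proof eventually_elim
    case (elim \<omega>)
    have \<omega>: "\<omega> k \<in> {1..N}" if "k \<ge> 1" for k
      using elim(2) that by (auto simp: label_measure_def space_PiM space_point_measure PiE_iff)
    let ?F = "random_set M r b \<omega>"
    have cov: "\<exists>\<U>. finite \<U> \<and> card \<U> \<le> M ^ n \<and> (\<forall>U\<in>\<U>. bounded U \<and> diameter U \<le> r ^ n) \<and> ?F \<subseteq> \<Union>\<U>" for n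
      using ifs r(1) \<omega> by (rule random_set_geometric_covers)
    have pos: "\<exists>\<delta>>0. hausdorff_premeasure t \<delta> ?F > 0" if t: "0 < t" "t < s" for t
    proof -
      \<comment> \<open>makes the mass bound \<open>(x M) powr (- n)\<close> for light words equal to \<open>(r ^ n) powr t\<close>; below 1 because \<open>t < s\<close>\<close>
      define x where "x = inverse (real M * r powr t)"
      have M0: "real M > 0" using assms(2) by simp
      have "inverse (real M) < r powr t"
        using powr_less_mono'[OF r t(2)] by (simp add: rs)
      then have "1 < real M * r powr t" using M0 by (simp add: field_simps)
      then have "x < 1" unfolding x_def inverse_less_1_iff by simp
      moreover have "0 < x" using M0 r by (simp add: x_def)
      ultimately have x: "0 < x" "x < 1" by simp_all
      have "r powr t = inverse (x * real M)" using M0 by (simp add: x_def)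
      moreover have "summable (\<lambda>n. (x / real M) ^ n * real (coincidences M \<omega> n))"
        using elim(1) x by simp
      moreover have "M \<ge> 1" using assms(2) by simp
      ultimately show ?thesis
        by (intro hausdorff_premeasure_random_set_pos[OF ifs r \<omega> _ x(1) _ t(1)])
    qed
    have "(\<lambda>_. 1) \<in> infinite_words M" using assms(2) by (simp add: infinite_words_def)
    with ifs r \<omega> have "\<exists>x\<in>?F. \<forall>n. x \<in> cylinder r b (label_word M \<omega> (word_prefix (\<lambda>_. 1) n))"
      by (rule random_set_point)
    then have ne: "?F \<noteq> {}" by blast
    have bdd: "bounded ?F"
    proof -
      have "?F \<subseteq> (\<Union>v\<in>words M 0. cylinder r b (label_word M \<omega> v))"
        using ifs r(1) \<omega> by (rule random_set_cover)
      then have "?F \<subseteq> {0..1}" by (simp add: cylinder_def)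
      then show ?thesis by (rule bounded_subset[rotated]) simp
    qed
    have M1: "M \<ge> 1" using assms(2) by simp
    have "hausdorff_dim ?F = ereal s"
      using hausdorff_dim_le_of_geometric_covers[OF r M1 cov] hausdorff_dim_geI[OF s0 pos]
      by (intro antisym) (auto simp: s_def)
    moreover have "has_box_dim ?F s"
      unfolding s_def using ne bdd r assms(2) cov pos[unfolded s_def] by (rule has_box_dimI)
    ultimately show ?case by (simp add: s_def)
  qed
qed

end
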